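(* Let $G$ be a finite abelian group with $|G|>1$, and let $p(G)$ denote the least prime divisor of $|G|$. Then for every integer $k\geq 0$ and every non-empty subset $A\subseteq G$, $$|k^\wedge A|\geq\min\{p(G),\ k|A|-k^2+1\}.$$
   Context: For a subset $A$ of an abelian group $G$ and an integer $k\geq 1$, the restricted sumset is $k^\wedge A:=\{a_1+\cdots+a_k:\ a_1,\ldots,a_k\in A,\ a_i\neq a_j \text{ for } i\neq j\}$; by convention $1^\wedge A=A$ and $0^\wedge A=\{0\}$. (If $k>|A|$, then $k^\wedge A=\emptyset$.) *)

theory Defs
  imports "HOL-Algebra.FiniteProduct" "HOL-Algebra.Coset" "HOL-Computational_Algebra.Primes"
begin

text \<open>The ambient abelian group is a \<^locale>\<open>comm_group\<close> and hence written multiplicatively: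
  the sum \<open>a\<^sub>1 + \<dots> + a\<^sub>k\<close> becomes a \<^const>\<open>finprod\<close>, and \<open>0\<close> becomes \<open>\<one>\<close>.\<close>

definition restricted_sumset :: "('a, 'b) monoid_scheme \<Rightarrow> nat \<Rightarrow> 'a set \<Rightarrow> 'a set" where
  "restricted_sumset G k A =
     {(\<Otimes>\<^bsub>G\<^esub>i\<in>{1..k}. a i) | a. a \<in> {1..k} \<rightarrow> A \<and> inj_on a {1..k}}"

definition least_prime_divisor :: "nat \<Rightarrow> nat" where
  "least_prime_divisor n = (LEAST p. prime p \<and> p dvd n)"

text \<open>The conventions for \<open>k = 0\<close>, \<open>k = 1\<close> and \<open>k > |A|\<close> follow from the definition.\<close>

lemma (in comm_monoid) restricted_sumset_0: "restricted_sumset G 0 A = {\<one>}"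
  by (simp add: restricted_sumset_def)

lemma (in comm_monoid) restricted_sumset_1:
  assumes "A \<subseteq> carrier G"
  shows "restricted_sumset G 1 A = A"
proof -
  have eq: "(\<Otimes>i\<in>{1..1::nat}. a i) = a 1" if "a 1 \<in> A" for a
    using that assms by (auto simp: Pi_def)
  show ?thesis
  proof
    show "restricted_sumset G 1 A \<subseteq> A"
      unfolding restricted_sumset_def using eq by fastforce
    show "A \<subseteq> restricted_sumset G 1 A"
    proof
      fix x assume "x \<in> A"
      then show "x \<in> restricted_sumset G 1 A"
        unfolding restricted_sumset_def using eq[of "\<lambda>_. x"]
        by (intro CollectI exI[of _ "\<lambda>_. x"]) auto
    qed
  qed
qed

lemma restricted_sumset_empty:
  assumes "finite A" and "card A < k"
  shows "restricted_sumset G k A = {}"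
proof -
  have False if "a \<in> {1..k} \<rightarrow> A" "inj_on a {1..k}" for a
    using card_inj_on_le[OF that(2) _ assms(1)] that(1) assms(2) by auto
  then show ?thesis
    unfolding restricted_sumset_def by blast
qed

end

theory Submission
  imports Defs "HOL-Algebra.Multiplicative_Group" "HOL-Computational_Algebra.Polynomial"
    "HOL-Combinatorics.Permutations" "HOL-Library.Multiset"
begin

text \<open>The proof is by induction along a chain of subgroups. Let \<open>K\<close> have prime index \<open>q\<close> in \<open>H\<close>, let
  \<open>n v\<close> be the number of elements of \<open>A\<close> in the \<open>v\<close>-th coset of \<open>K\<close>, and let \<open>N = |A|\<close>; one can
  assume \<open>N \<le> q\<close>. If \<open>\<kappa> v\<close> of the \<open>k\<close> summands are taken from the \<open>v\<close>-th coset, then the induction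
  hypothesis and the Cauchy-Davenport inequality give at least \<open>\<Sum>\<^sub>v \<kappa> v * (n v - \<kappa> v) + 1\<close> elements of
  the restricted sumset in the coset \<open>\<Sum>\<^sub>v \<kappa> v * v\<close> (or at least \<open>p(G)\<close> of them).

  These bounds are added up as in the proof of Dias da Silva and Hamidoune for \<open>\<int>/q\<close>. Let \<open>V\<close> be the
  quotient of \<open>(\<int>/q)[X]\<close> by \<open>\<Prod>\<^sub>v (X - v)\<^bsup>n v\<^esup>\<close>, and let \<open>D\<close> be the derivation of the \<open>k\<close>-th exterior
  power of \<open>V\<close> induced by \<open>X\<close>. On the summand of type \<open>\<kappa>\<close> in the primary decomposition, \<open>D\<close> minus its
  eigenvalue \<open>\<Sum>\<^sub>v \<kappa> v * v\<close> is nilpotent of index at most \<open>\<Sum>\<^sub>v \<kappa> v * (n v - \<kappa> v) + 1\<close>. So if \<open>m y\<close> is the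
  number of elements of the sumset in the \<open>y\<close>-th coset, then \<open>\<Prod>\<^sub>y (D - y)\<^bsup>m y\<^esup> = 0\<close>. On the other hand,
  for \<open>M = min (q - 1) (k * (N - k))\<close> no monic polynomial of degree \<open>M\<close> in \<open>D\<close> kills
  \<open>1 \<and> X \<and> \<dots> \<and> X\<^bsup>k-1\<^esup>\<close>, since some coefficient of the image is \<open>M!\<close> times a Vandermonde
  determinant, up to a unit. All computations take place over \<open>\<int>\<close> modulo \<open>q\<close>, and alternating forms
  replace the exterior power.\<close>

hide_const (open) Polynomial.order

section \<open>Alternating forms on tuples of polynomials\<close>

text \<open>Slots from \<open>k\<close> on remain free parameters. Alternation is encoded as a sign
  change under swaps, which over the integers already forces zero on equal arguments.\<close>

definition alternating_form :: "nat \<Rightarrow> ((nat \<Rightarrow> int poly) \<Rightarrow> int) \<Rightarrow> bool" where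
  "alternating_form k W \<longleftrightarrow>
     (\<forall>u i v w. i < k \<longrightarrow> W (u(i := v + w)) = W (u(i := v)) + W (u(i := w))) \<and>
     (\<forall>u i c v. i < k \<longrightarrow> W (u(i := smult c v)) = c * W (u(i := v))) \<and>
     (\<forall>u i j. i < k \<longrightarrow> j < k \<longrightarrow> i \<noteq> j \<longrightarrow> W (u \<circ> transpose i j) = - W u)"

context
  fixes k :: nat and W :: "(nat \<Rightarrow> int poly) \<Rightarrow> int"
  assumes W: "alternating_form k W"
begin

lemma alternating_form_add:
  "i < k \<Longrightarrow> W (u(i := v + w)) = W (u(i := v)) + W (u(i := w))"
  using W unfolding alternating_form_def by blast

lemma alternating_form_smult: "i < k \<Longrightarrow> W (u(i := smult c v)) = c * W (u(i := v))"
  using W unfolding alternating_form_def by blast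

lemma alternating_form_swap:
  "i < k \<Longrightarrow> j < k \<Longrightarrow> i \<noteq> j \<Longrightarrow> W (u \<circ> transpose i j) = - W u"
  using W unfolding alternating_form_def by blast

lemma alternating_form_zero: "i < k \<Longrightarrow> W (u(i := 0)) = 0"
  using alternating_form_smult[of i u 0 0] by simp

lemma alternating_form_diff:
  "i < k \<Longrightarrow> W (u(i := v - w)) = W (u(i := v)) - W (u(i := w))"
  using alternating_form_add[of i u "v - w" w] by simp

lemma alternating_form_eq:
  assumes "i < k" "j < k" "i \<noteq> j" "u i = u j"
  shows "W u = 0"
proof -
  have "u \<circ> transpose i j = u"
    using assms(4) by (auto simp: fun_eq_iff transpose_def)
  then show ?thesis
    using alternating_form_swap[OF assms(1-3), of u] by simp
qed

end

text \<open>The transpose of \<open>D - y\<close> acting on alternating forms, where \<open>D\<close> is the derivation of the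
  exterior algebra of \<open>\<int>[X]\<close> that extends multiplication by \<open>X\<close>.\<close>

definition shift_op :: "nat \<Rightarrow> int \<Rightarrow> ((nat \<Rightarrow> int poly) \<Rightarrow> int) \<Rightarrow> (nat \<Rightarrow> int poly) \<Rightarrow> int" where
  "shift_op k y W u = (\<Sum>i<k. W (u(i := [:0, 1:] * u i))) - y * W u"

text \<open>In each summand the slot multiplied by X is either the slot in question or another one,
  and then the updates commute. A swap only permutes the summands.\<close>

lemma alternating_form_shift_op:
  assumes W: "alternating_form k W"
  shows "alternating_form k (shift_op k y W)"
  unfolding alternating_form_def
proof (intro conjI allI impI)
  fix u :: "nat \<Rightarrow> int poly" and i v w
  assume i: "i < k"
  let ?X = "[:0, 1:] :: int poly"
  have "W ((u(i := v + w))(l := ?X * (u(i := v + w)) l)) =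
        W ((u(i := v))(l := ?X * (u(i := v)) l)) + W ((u(i := w))(l := ?X * (u(i := w)) l))" for l
  proof (cases "l = i")
    case True
    then show ?thesis
      using alternating_form_add[OF W i, of u "?X * v" "?X * w"] by (simp add: distrib_left)
  next
    case False
    then show ?thesis
      using alternating_form_add[OF W i, of "u(l := ?X * u l)" v w]
      by (simp add: fun_upd_twist[of l i])
  qed
  then show "shift_op k y W (u(i := v + w)) =
      shift_op k y W (u(i := v)) + shift_op k y W (u(i := w))"
    unfolding shift_op_def
    by (simp add: alternating_form_add[OF W i] sum.distrib algebra_simps del: mult_pCons_left)
next
  fix u :: "nat \<Rightarrow> int poly" and i c v
  assume i: "i < k"
  let ?X = "[:0, 1:] :: int poly"
  have "W ((u(i := smult c v))(l := ?X * (u(i := smult c v)) l)) =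
        c * W ((u(i := v))(l := ?X * (u(i := v)) l))" for l
  proof (cases "l = i")
    case True
    then show ?thesis
      using alternating_form_smult[OF W i, of u c "?X * v"] by simp
  next
    case False
    then show ?thesis
      using alternating_form_smult[OF W i, of "u(l := ?X * u l)" c v]
      by (simp add: fun_upd_twist[of l i])
  qed
  then show "shift_op k y W (u(i := smult c v)) = c * shift_op k y W (u(i := v))"
    unfolding shift_op_def
    by (simp add: alternating_form_smult[OF W i] sum_distrib_left algebra_simps
        del: mult_pCons_left)
next
  fix u :: "nat \<Rightarrow> int poly" and i j
  assume ij: "i < k" "j < k" "i \<noteq> j"
  let ?X = "[:0, 1:] :: int poly"
  let ?t = "transpose i j"
  have t: "?t permutes {..<k}"
    using ij by (simp add: permutes_swap_id)
  have "(u \<circ> ?t)(l := ?X * (u \<circ> ?t) l) = u(?t l := ?X * u (?t l)) \<circ> ?t" for l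
    by (auto simp: fun_eq_iff transpose_eq_iff transpose_involutory)
  then have "(\<Sum>l<k. W ((u \<circ> ?t)(l := ?X * (u \<circ> ?t) l))) =
      (\<Sum>l<k. - W (u(?t l := ?X * u (?t l))))"
    by (simp add: alternating_form_swap[OF W ij])
  also have "\<dots> = - (\<Sum>l<k. W (u(l := ?X * u l)))"
    using sum.permute[OF t, of "\<lambda>l. - W (u(l := ?X * u l))"]
    by (simp add: o_def sum_negf)
  finally show "shift_op k y W (u \<circ> ?t) = - shift_op k y W u"
    unfolding shift_op_def by (simp add: alternating_form_swap[OF W ij])
qed

lemma alternating_form_foldr_shift_op:
  "alternating_form k W \<Longrightarrow> alternating_form k (foldr (shift_op k) ys W)"
  by (induction ys) (auto intro: alternating_form_shift_op)

text \<open>For an alternating form this says that it descends to tuples over the quotient of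
  \<open>int poly\<close> by the ideal of \<open>P\<close>.\<close>

definition kills_multiples :: "nat \<Rightarrow> int poly \<Rightarrow> ((nat \<Rightarrow> int poly) \<Rightarrow> int) \<Rightarrow> bool" where
  "kills_multiples k P W \<longleftrightarrow> (\<forall>u i. i < k \<longrightarrow> P dvd u i \<longrightarrow> W u = 0)"

lemma kills_multiplesD: "kills_multiples k P W \<Longrightarrow> i < k \<Longrightarrow> P dvd u i \<Longrightarrow> W u = 0"
  unfolding kills_multiples_def by blast

lemma kills_multiples_foldr_shift_op:
  assumes "kills_multiples k P W"
  shows "kills_multiples k P (foldr (shift_op k) ys W)"
proof (induction ys)
  case Nil
  then show ?case using assms by simp
next
  case (Cons y ys)
  show ?case
    unfolding kills_multiples_def
  proof (intro allI impI)
    fix u :: "nat \<Rightarrow> int poly" and i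
    assume i: "i < k" "P dvd u i"
    then have "foldr (shift_op k) ys W (u(l := [:0, 1:] * u l)) = 0" for l
      by (intro kills_multiplesD[OF Cons.IH i(1)]) (auto intro: dvd_mult simp del: mult_pCons_left)
    moreover have "foldr (shift_op k) ys W u = 0"
      using kills_multiplesD[OF Cons.IH i(1), of u] i(2) by simp
    ultimately show "foldr (shift_op k) (y # ys) W u = 0"
      by (simp add: shift_op_def del: mult_pCons_left)
  qed
qed

text \<open>Both families of vectors used below let X act on slot \<open>i\<close> as a scalar
  \<open>b i\<close> plus a correction \<open>v i\<close>. The scalars add up to one eigenvalue; the
  corrections enter one slot at a time.\<close>

lemma shift_op_eigen:
  assumes W: "alternating_form k W"
    and u: "\<And>i. i < k \<Longrightarrow> [:0, 1:] * u i = v i + smult (b i) (u i)"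
  shows "shift_op k y W u = (\<Sum>i<k. W (u(i := v i))) + ((\<Sum>i<k. b i) - y) * W u"
proof -
  have "W (u(i := [:0, 1:] * u i)) = W (u(i := v i)) + b i * W u" if "i < k" for i
    using alternating_form_add[OF W that, of u "v i" "smult (b i) (u i)"]
      alternating_form_smult[OF W that, of u "b i" "u i"] u[OF that] by simp
  then show ?thesis
    unfolding shift_op_def
    by (simp add: sum.distrib sum_distrib_right left_diff_distrib del: mult_pCons_left)
qed

text \<open>The wedge product of the functionals \<open>\<phi> 0\<close>, ...,
  \<open>\<phi> (k - 1)\<close>, as the determinant of the values
  \<open>\<phi> j (u i)\<close>.\<close>

definition leibniz_form :: "nat \<Rightarrow> (nat \<Rightarrow> int poly \<Rightarrow> int) \<Rightarrow> (nat \<Rightarrow> int poly) \<Rightarrow> int" where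
  "leibniz_form k \<phi> u = (\<Sum>\<sigma> | \<sigma> permutes {..<k}. sign \<sigma> * (\<Prod>i<k. \<phi> (\<sigma> i) (u i)))"

lemma alternating_form_leibniz_form:
  assumes add: "\<And>j u v. j < k \<Longrightarrow> \<phi> j (u + v) = \<phi> j u + \<phi> j v"
    and smult: "\<And>j c u. j < k \<Longrightarrow> \<phi> j (smult c u) = c * \<phi> j u"
  shows "alternating_form k (leibniz_form k \<phi>)"
  unfolding alternating_form_def
proof (intro conjI allI impI)
  fix u :: "nat \<Rightarrow> int poly" and i v w
  assume i: "i < k"
  have *: "(\<Prod>l<k. \<phi> (\<sigma> l) ((u(i := x)) l)) = \<phi> (\<sigma> i) x * (\<Prod>l\<in>{..<k} - {i}. \<phi> (\<sigma> l) (u l))" for \<sigma> x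
    using i by (subst prod.remove[of _ i]) (auto intro!: prod.cong)
  show "leibniz_form k \<phi> (u(i := v + w)) = leibniz_form k \<phi> (u(i := v)) + leibniz_form k \<phi> (u(i := w))"
    unfolding leibniz_form_def * sum.distrib[symmetric]
  proof (intro sum.cong refl)
    fix \<sigma> assume "\<sigma> \<in> {\<sigma>. \<sigma> permutes {..<k}}"
    then have "\<sigma> i < k" using i permutes_in_image[of \<sigma> "{..<k}" i] by auto
    then show "sign \<sigma> * (\<phi> (\<sigma> i) (v + w) * (\<Prod>l\<in>{..<k} - {i}. \<phi> (\<sigma> l) (u l))) =
      sign \<sigma> * (\<phi> (\<sigma> i) v * (\<Prod>l\<in>{..<k} - {i}. \<phi> (\<sigma> l) (u l))) +
      sign \<sigma> * (\<phi> (\<sigma> i) w * (\<Prod>l\<in>{..<k} - {i}. \<phi> (\<sigma> l) (u l)))"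
      by (simp add: add algebra_simps)
  qed
next
  fix u :: "nat \<Rightarrow> int poly" and i c v
  assume i: "i < k"
  have *: "(\<Prod>l<k. \<phi> (\<sigma> l) ((u(i := x)) l)) = \<phi> (\<sigma> i) x * (\<Prod>l\<in>{..<k} - {i}. \<phi> (\<sigma> l) (u l))" for \<sigma> x
    using i by (subst prod.remove[of _ i]) (auto intro!: prod.cong)
  show "leibniz_form k \<phi> (u(i := smult c v)) = c * leibniz_form k \<phi> (u(i := v))"
    unfolding leibniz_form_def * sum_distrib_left
  proof (intro sum.cong refl)
    fix \<sigma> assume "\<sigma> \<in> {\<sigma>. \<sigma> permutes {..<k}}"
    then have "\<sigma> i < k" using i permutes_in_image[of \<sigma> "{..<k}" i] by auto
    then show "sign \<sigma> * (\<phi> (\<sigma> i) (smult c v) * (\<Prod>l\<in>{..<k} - {i}. \<phi> (\<sigma> l) (u l))) =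
      c * (sign \<sigma> * (\<phi> (\<sigma> i) v * (\<Prod>l\<in>{..<k} - {i}. \<phi> (\<sigma> l) (u l))))"
      by (simp add: smult algebra_simps)
  qed
next
  fix u :: "nat \<Rightarrow> int poly" and i j
  assume ij: "i < k" "j < k" "i \<noteq> j"
  let ?t = "transpose i j"
  have t: "?t permutes {..<k}"
    using ij by (simp add: permutes_swap_id)
  have "leibniz_form k \<phi> (u \<circ> ?t) =
      (\<Sum>\<sigma> | \<sigma> permutes {..<k}. sign (\<sigma> \<circ> ?t) * (\<Prod>l<k. \<phi> ((\<sigma> \<circ> ?t) l) ((u \<circ> ?t) l)))"
    unfolding leibniz_form_def by (rule sum_permutations_compose_right[OF t])
  also have "\<dots> = (\<Sum>\<sigma> | \<sigma> permutes {..<k}. - (sign \<sigma> * (\<Prod>l<k. \<phi> (\<sigma> l) (u l))))"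
  proof (intro sum.cong refl)
    fix \<sigma> assume "\<sigma> \<in> {\<sigma>. \<sigma> permutes {..<k}}"
    then have "permutation \<sigma>" by (auto intro: permutes_imp_permutation)
    then have "sign (\<sigma> \<circ> ?t) = - sign \<sigma>"
      using ij(3) by (simp add: sign_compose sign_swap_id permutation_swap_id)
    moreover have "(\<Prod>l<k. \<phi> ((\<sigma> \<circ> ?t) l) ((u \<circ> ?t) l)) = (\<Prod>l<k. \<phi> (\<sigma> l) (u l))"
      using prod.permute[OF t, of "\<lambda>l. \<phi> (\<sigma> l) (u l)"] by (simp add: o_def)
    ultimately show "sign (\<sigma> \<circ> ?t) * (\<Prod>l<k. \<phi> ((\<sigma> \<circ> ?t) l) ((u \<circ> ?t) l)) =
        - (sign \<sigma> * (\<Prod>l<k. \<phi> (\<sigma> l) (u l)))" by simp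
  qed
  also have "\<dots> = - leibniz_form k \<phi> u"
    by (simp add: leibniz_form_def sum_negf)
  finally show "leibniz_form k \<phi> (u \<circ> ?t) = - leibniz_form k \<phi> u" .
qed

lemma kills_multiples_leibniz_form:
  assumes "\<And>j u. j < k \<Longrightarrow> P dvd u \<Longrightarrow> \<phi> j u = 0"
  shows "kills_multiples k P (leibniz_form k \<phi>)"
  unfolding kills_multiples_def leibniz_form_def
proof (intro allI impI sum.neutral ballI)
  fix u :: "nat \<Rightarrow> int poly" and i \<sigma>
  assume "i < k" "P dvd u i" "\<sigma> \<in> {\<sigma>. \<sigma> permutes {..<k}}"
  then have "\<phi> (\<sigma> i) (u i) = 0"
    using permutes_in_image[of \<sigma> "{..<k}" i] by (intro assms) auto
  then show "sign \<sigma> * (\<Prod>l<k. \<phi> (\<sigma> l) (u l)) = 0"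
    using \<open>i < k\<close> by auto
qed

text \<open>The monic entries in the first \<open>m\<close> slots span all polynomials of degree
  below \<open>m\<close>. Stripping leading terms expands \<open>h\<close> in them, and every term
  repeats an argument.\<close>

lemma alternating_form_low_degree:
  assumes W: "alternating_form k W" and "m < k"
    and u: "\<And>i. i < m \<Longrightarrow> degree (u i) = i \<and> coeff (u i) i = 1"
    and "degree h < m \<or> h = 0"
  shows "W (u(m := h)) = 0"
  using assms(4)
proof (induction "degree h" arbitrary: h rule: less_induct)
  case less
  show ?case
  proof (cases "h = 0")
    case True
    then show ?thesis by (simp add: alternating_form_zero[OF W \<open>m < k\<close>])
  next
    case False
    define d where "d = degree h"
    have d: "d < m" using less.prems False by (simp add: d_def)
    define g where "g = h - smult (lead_coeff h) (u d)"
    have deg: "degree (u d) = d" "coeff (u d) d = 1" using u[OF d] by auto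
    have g: "degree g < d \<or> g = 0"
    proof -
      have "degree g \<le> d"
        unfolding g_def using deg by (intro degree_diff_le) (auto simp: d_def)
      moreover have "coeff g d = 0"
        using deg unfolding g_def by (simp add: d_def)
      ultimately show ?thesis
        using eq_zero_or_degree_less by blast
    qed
    have "W (u(m := g)) = 0"
    proof (cases "g = 0")
      case True
      then show ?thesis by (simp add: alternating_form_zero[OF W \<open>m < k\<close>])
    next
      case False
      then show ?thesis using less.hyps[of g] g d by (auto simp: d_def)
    qed
    moreover have "W (u(m := u d)) = 0"
      by (rule alternating_form_eq[OF W, of d m]) (use d \<open>m < k\<close> in auto)
    moreover have "h = g + smult (lead_coeff h) (u d)"
      by (simp add: g_def)
    ultimately show ?thesis
      using alternating_form_add[OF W \<open>m < k\<close>, of u g "smult (lead_coeff h) (u d)"]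
        alternating_form_smult[OF W \<open>m < k\<close>, of u "lead_coeff h" "u d"] by simp
  qed
qed

text \<open>The change of basis is unitriangular. Slots are exchanged from below, so the difference
  of the two candidates for slot \<open>m\<close> is absorbed by the slots already
  exchanged.\<close>

lemma alternating_form_monic_cong:
  assumes W: "alternating_form k W"
    and f: "\<And>i. i < k \<Longrightarrow> degree (f i) = i \<and> coeff (f i) i = 1"
    and g: "\<And>i. i < k \<Longrightarrow> degree (g i) = i \<and> coeff (g i) i = 1"
    and "\<And>i. i \<ge> k \<Longrightarrow> f i = g i"
  shows "W f = W g"
proof -
  have "W (\<lambda>i. if i < m then g i else f i) = W f" if "m \<le> k" for m
    using that
  proof (induction m)
    case (Suc m)
    let ?u = "\<lambda>i. if i < m then g i else f i"
    have m: "m < k" using Suc.prems by simp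
    have low: "degree (g m - f m) < m \<or> g m - f m = 0"
    proof -
      have "degree (g m - f m) \<le> m" 
        using f[OF m] g[OF m] by (intro degree_diff_le) auto
      moreover have "coeff (g m - f m) m = 0"
        using f[OF m] g[OF m] by simp
      ultimately show ?thesis
        using eq_zero_or_degree_less by blast
    qed
    have "degree (?u i) = i \<and> coeff (?u i) i = 1" if "i < m" for i
      using g[of i] m that by simp
    then have "W (?u(m := g m - f m)) = 0"
      by (rule alternating_form_low_degree[OF W m _ low])
    then have "W (?u(m := g m)) = W (?u(m := f m))"
      using alternating_form_diff[OF W m, of ?u "g m" "f m"] by simp
    moreover have "?u(m := g m) = (\<lambda>i. if i < Suc m then g i else f i)"
      by (auto simp: fun_eq_iff)
    moreover have "?u(m := f m) = ?u"
      by (auto simp: fun_eq_iff)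
    ultimately show ?case
      using Suc by simp
  qed simp
  moreover have "(\<lambda>i. if i < k then g i else f i) = g"
    using assms(4) by (auto simp: fun_eq_iff)
  ultimately show ?thesis by (metis order_refl)
qed

section \<open>Newton interpolation and the Vandermonde determinant\<close>

definition newton_poly :: "(nat \<Rightarrow> int) \<Rightarrow> nat \<Rightarrow> int poly" where
  "newton_poly \<beta> a = (\<Prod>l<a. [:- \<beta> l, 1:])"

lemma newton_poly_0 [simp]: "newton_poly \<beta> 0 = 1"
  by (simp add: newton_poly_def)

lemma newton_poly_Suc: "newton_poly \<beta> (Suc a) = [:- \<beta> 0, 1:] * newton_poly (\<beta> \<circ> Suc) a"
  unfolding newton_poly_def by (subst prod.lessThan_Suc_shift) simp

text \<open>X is bidiagonal in the Newton basis: it raises the index by one, with the nodes on the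
  diagonal.\<close>

lemma X_mult_newton_poly:
  "[:0, 1:] * newton_poly \<beta> a = newton_poly \<beta> (Suc a) + smult (\<beta> a) (newton_poly \<beta> a)"
proof -
  have "newton_poly \<beta> (Suc a) = newton_poly \<beta> a * [:- \<beta> a, 1:]"
    by (simp add: newton_poly_def mult.commute)
  also have "[:- \<beta> a, 1:] = [:0, 1:] - [:\<beta> a:]" by simp
  finally show ?thesis by (simp add: algebra_simps)
qed

lemma degree_newton_poly:
  "degree (newton_poly \<beta> a) = a" "coeff (newton_poly \<beta> a) a = 1"
proof -
  show *: "degree (newton_poly \<beta> a) = a"
    unfolding newton_poly_def by (subst degree_prod_eq_sum_degree) auto
  have "lead_coeff (newton_poly \<beta> a) = 1"
    by (simp only: newton_poly_def lead_coeff_prod) simp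
  then show "coeff (newton_poly \<beta> a) a = 1"
    using * by simp
qed

lemma poly_newton_poly: "poly (newton_poly \<beta> a) x = (\<Prod>l<a. x - \<beta> l)"
  unfolding newton_poly_def by (simp add: poly_prod)

text \<open>The coefficient functionals of the Newton basis. Dividing off the nodes one by one,
  instead of forming difference quotients, keeps values integral and permits repeated nodes, which
  arise when a coset contains several elements of \<open>A\<close>.\<close>

primrec divided_difference :: "nat \<Rightarrow> (nat \<Rightarrow> int) \<Rightarrow> int poly \<Rightarrow> int" where
  "divided_difference 0 \<beta> u = poly u (\<beta> 0)"
| "divided_difference (Suc c) \<beta> u = divided_difference c (\<beta> \<circ> Suc) (synthetic_div u (\<beta> 0))"

lemma synthetic_div_add:
  fixes u v :: "int poly"
  shows "synthetic_div (u + v) b = synthetic_div u b + synthetic_div v b"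
proof -
  have "u + v + smult b (synthetic_div u b + synthetic_div v b) =
      (u + smult b (synthetic_div u b)) + (v + smult b (synthetic_div v b))"
    by (simp add: algebra_simps smult_add_right)
  also have "\<dots> = pCons (poly u b + poly v b) (synthetic_div u b + synthetic_div v b)"
    by (simp only: synthetic_div_correct) simp
  finally show ?thesis by (rule synthetic_div_unique[THEN conjunct2, symmetric])
qed

lemma synthetic_div_smult:
  fixes u :: "int poly"
  shows "synthetic_div (smult c u) b = smult c (synthetic_div u b)"
proof -
  have "smult c u + smult b (smult c (synthetic_div u b)) = smult c (u + smult b (synthetic_div u b))"
    by (simp add: algebra_simps smult_add_right)
  also have "\<dots> = pCons (c * poly u b) (smult c (synthetic_div u b))"
    by (simp only: synthetic_div_correct) simp
  finally show ?thesis by (rule synthetic_div_unique[THEN conjunct2, symmetric])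
qed

lemma synthetic_div_linear_mult:
  fixes g :: "int poly"
  shows "synthetic_div ([:- b, 1:] * g) b = g"
proof -
  have "[:- b, 1:] * g + smult b g = pCons 0 g" by simp
  then show ?thesis by (rule synthetic_div_unique[THEN conjunct2, symmetric])
qed

lemma divided_difference_add:
  "divided_difference c \<beta> (u + v) = divided_difference c \<beta> u + divided_difference c \<beta> v"
  by (induction c arbitrary: \<beta> u v) (auto simp: synthetic_div_add)

lemma divided_difference_smult:
  "divided_difference c \<beta> (smult d u) = d * divided_difference c \<beta> u"
  by (induction c arbitrary: \<beta> u) (auto simp: synthetic_div_smult)

lemma divided_difference_zero: "divided_difference c \<beta> 0 = 0"
  by (induction c arbitrary: \<beta>) auto

lemma divided_difference_newton_mult:
  "c < a \<Longrightarrow> divided_difference c \<beta> (newton_poly \<beta> a * g) = 0"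
proof (induction c arbitrary: a \<beta>)
  case 0
  then obtain b where "a = Suc b" by (cases a) auto
  then show ?case by (simp add: newton_poly_Suc)
next
  case (Suc c)
  then obtain b where b: "a = Suc b" "c < b" by (cases a) auto
  then show ?case
    using Suc.IH[OF b(2)]
    by (simp add: newton_poly_Suc mult.assoc synthetic_div_linear_mult del: mult_pCons_left)
qed

lemma divided_difference_newton:
  "divided_difference c \<beta> (newton_poly \<beta> a) = (if a = c then 1 else 0)"
proof (induction c arbitrary: a \<beta>)
  case 0
  then show ?case
    by (cases a) (simp_all add: newton_poly_Suc)
next
  case (Suc c)
  show ?case
  proof (cases a)
    case 0
    have "synthetic_div (1 :: int poly) (\<beta> 0) = 0"
      by (simp add: synthetic_div_eq_0_iff)
    then show ?thesis using 0 by (simp add: divided_difference_zero)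
  next
    case (Suc b)
    then show ?thesis
      unfolding Suc newton_poly_Suc divided_difference.simps synthetic_div_linear_mult Suc.IH by simp
  qed
qed

text \<open>The falling factorial, written as a Newton polynomial with nodes 0, 1, 2, ... so that
  determinants of such values become forms evaluated on monic polynomials.\<close>

definition falling :: "nat \<Rightarrow> nat \<Rightarrow> int" where
  "falling c a = poly (newton_poly int a) (int c)"

lemma falling_Suc: "falling c (Suc a) = falling c a * (int c - int a)"
  by (simp add: falling_def poly_newton_poly)

lemma falling_self: "falling c c = fact c"
proof -
  have "falling c c = (\<Prod>l<c. int (c - l))"
    unfolding falling_def poly_newton_poly by (intro prod.cong) (auto simp: of_nat_diff)
  also have "\<dots> = int (\<Prod>{1..c})"
    unfolding of_nat_prod
    by (rule prod.reindex_bij_witness[of _ "\<lambda>i. c - i" "\<lambda>i. c - i"]) auto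
  also have "\<dots> = fact c" by (simp add: fact_prod)
  finally show ?thesis .
qed

lemma falling_eq_0: "c < a \<Longrightarrow> falling c a = 0"
  unfolding falling_def poly_newton_poly by (intro prod_zero) auto

text \<open>For distinct indices \<open>c 0\<close>, ..., \<open>c (k - 1)\<close> this is the
  coordinate of a wedge product at the wedge of the Newton polynomials with these indices.\<close>

definition newton_form :: "nat \<Rightarrow> (nat \<Rightarrow> int) \<Rightarrow> (nat \<Rightarrow> nat) \<Rightarrow> (nat \<Rightarrow> int poly) \<Rightarrow> int" where
  "newton_form k \<beta> c = leibniz_form k (\<lambda>j. divided_difference (c j) \<beta>)"

lemma alternating_form_newton_form: "alternating_form k (newton_form k \<beta> c)"
  unfolding newton_form_def
  by (rule alternating_form_leibniz_form)
    (auto simp: divided_difference_add divided_difference_smult)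

lemma kills_multiples_newton_form:
  assumes "\<And>j. j < k \<Longrightarrow> c j < n"
  shows "kills_multiples k (newton_poly \<beta> n) (newton_form k \<beta> c)"
  unfolding newton_form_def
  by (rule kills_multiples_leibniz_form) (auto simp: assms divided_difference_newton_mult elim!: dvdE)

lemma newton_form_newton:
  "newton_form k \<beta> c (\<lambda>i. newton_poly \<beta> (a i)) =
     (\<Sum>\<sigma> | \<sigma> permutes {..<k}. sign \<sigma> * (if \<forall>i<k. a i = c (\<sigma> i) then 1 else 0))"
  unfolding newton_form_def leibniz_form_def divided_difference_newton
  by (intro sum.cong refl) auto

text \<open>For \<open>a i = i\<close> this is the Vandermonde determinant of \<open>c\<close>. The coefficient of \<open>e\<^bsub>c 0\<^esub> \<and> \<dots> \<and> e\<^bsub>c (k-1)\<^esub>\<close>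
  in \<open>D\<^sup>M (e\<^bsub>a 0\<^esub> \<and> \<dots> \<and> e\<^bsub>a (k-1)\<^esub>)\<close>, for \<open>M = \<Sum> c - \<Sum> a\<close>, is the multinomial determinant
  \<open>M! * det (1 / (c j - a i)!)\<close>; multiplication by \<open>\<Prod> (c j)!\<close> clears the denominators.\<close>

abbreviation falling_form :: "nat \<Rightarrow> (nat \<Rightarrow> nat) \<Rightarrow> (nat \<Rightarrow> nat) \<Rightarrow> int" where
  "falling_form k c a \<equiv> (\<Sum>\<sigma> | \<sigma> permutes {..<k}. sign \<sigma> * (\<Prod>i<k. falling (c (\<sigma> i)) (a i)))"

lemma sum_compose_permutes: "\<sigma> permutes {..<k} \<Longrightarrow> (\<Sum>i<k. c (\<sigma> i)) = (\<Sum>i<(k::nat). c i)"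
  for c :: "nat \<Rightarrow> 'a::comm_monoid_add"
  using sum.permute[of \<sigma> "{..<k}" c] by (simp add: o_def)

text \<open>Each operator raises one Newton index or keeps all of them with a scalar. With too few
  operators the indices \<open>c\<close> are out of reach; with exactly enough, each must raise, so
  nodes and \<open>ys\<close> drop out and a signed count of paths remains.\<close>

lemma foldr_shift_op_newton:
  defines "E \<equiv> \<lambda>k \<beta> c ys. foldr (shift_op k) ys (newton_form k \<beta> c)"
  shows "((\<Sum>i<k. a i) + length ys < (\<Sum>i<k. c i) \<longrightarrow> E k \<beta> c ys (\<lambda>i. newton_poly \<beta> (a i)) = 0) \<and>
    ((\<Sum>i<k. a i) + length ys = (\<Sum>i<k. c i) \<longrightarrow>
      (\<Prod>i<k. fact (c i)) * E k \<beta> c ys (\<lambda>i. newton_poly \<beta> (a i)) =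
      fact (length ys) * falling_form k c a)"
proof (induction ys arbitrary: a)
  case Nil
  show ?case
  proof (intro conjI impI)
    assume less: "(\<Sum>i<k. a i) + length [] < (\<Sum>i<k. c i)"
    have False if "\<sigma> permutes {..<k}" "\<forall>i<k. a i = c (\<sigma> i)" for \<sigma>
      using less sum_compose_permutes[OF that(1), of c] that(2) by simp
    then show "E k \<beta> c [] (\<lambda>i. newton_poly \<beta> (a i)) = 0"
      unfolding E_def by (simp add: newton_form_newton) (intro sum.neutral, auto)
  next
    assume eq: "(\<Sum>i<k. a i) + length [] = (\<Sum>i<k. c i)"
    have "(\<Prod>i<k. fact (c i)) * (if \<forall>i<k. a i = c (\<sigma> i) then 1 else 0) =
        (\<Prod>i<k. falling (c (\<sigma> i)) (a i))" if \<sigma>: "\<sigma> permutes {..<k}" for \<sigma>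
    proof (cases "\<forall>i<k. a i = c (\<sigma> i)")
      case True
      then have "(\<Prod>i<k. falling (c (\<sigma> i)) (a i)) = (\<Prod>i<k. fact (c (\<sigma> i)))"
        by (intro prod.cong) (auto simp: falling_self)
      also have "\<dots> = (\<Prod>i<k. fact (c i))"
        using prod.permute[OF \<sigma>, of "\<lambda>i. fact (c i) :: int"] by (simp add: o_def)
      finally show ?thesis using True by simp
    next
      case False
      \<comment> \<open>The totals agree, so if the tuples differ, some \<open>a i\<close> is too
        large, and its falling factorial is zero.\<close>
      have "\<exists>i<k. c (\<sigma> i) < a i"
      proof (rule ccontr)
        assume "\<not> ?thesis"
        then have le: "a i \<le> c (\<sigma> i)" if "i < k" for i using that by (meson not_le)
        from False obtain i where "i < k" "a i \<noteq> c (\<sigma> i)" by blast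
        then have "(\<Sum>i<k. a i) < (\<Sum>i<k. c (\<sigma> i))"
          using le by (intro sum_strict_mono_ex1) (auto intro!: bexI[of _ i] simp: order_less_le)
        then show False using eq sum_compose_permutes[OF \<sigma>, of c] by simp
      qed
      then have "(\<Prod>i<k. falling (c (\<sigma> i)) (a i)) = 0"
        by (auto intro: falling_eq_0)
      then show ?thesis using False by auto
    qed
    then show "(\<Prod>i<k. fact (c i)) * E k \<beta> c [] (\<lambda>i. newton_poly \<beta> (a i)) =
      fact (length []) * falling_form k c a"
      unfolding E_def
      by (auto simp: newton_form_newton sum_distrib_left mult.left_commute intro!: sum.cong)
  qed
next
  case (Cons y ys)
  let ?N = "\<lambda>a i. newton_poly \<beta> (a i)"
  let ?a = "\<lambda>i. a(i := Suc (a i))"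
  have step: "E k \<beta> c (y # ys) (?N a) =
      (\<Sum>i<k. E k \<beta> c ys (?N (?a i))) + ((\<Sum>i<k. \<beta> (a i)) - y) * E k \<beta> c ys (?N a)"
  proof -
    have "E k \<beta> c (y # ys) (?N a) = shift_op k y (E k \<beta> c ys) (?N a)"
      by (simp add: E_def)
    also have "\<dots> = (\<Sum>i<k. E k \<beta> c ys ((?N a)(i := newton_poly \<beta> (Suc (a i))))) +
        ((\<Sum>i<k. \<beta> (a i)) - y) * E k \<beta> c ys (?N a)"
      unfolding E_def
      by (rule shift_op_eigen[OF alternating_form_foldr_shift_op[OF alternating_form_newton_form]])
        (rule X_mult_newton_poly)
    also have "(\<lambda>i. (?N a)(i := newton_poly \<beta> (Suc (a i)))) = (\<lambda>i. ?N (?a i))"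
      by (auto simp: fun_eq_iff)
    finally show ?thesis by (simp add: fun_eq_iff)
  qed
  have sum_a: "(\<Sum>l<k. ?a i l) = Suc (\<Sum>l<k. a l)" if "i < k" for i
    using that by (simp add: sum.remove[of "{..<k}" i])
  show ?case
  proof (intro conjI impI)
    assume less: "(\<Sum>i<k. a i) + length (y # ys) < (\<Sum>i<k. c i)"
    have "E k \<beta> c ys (?N (?a i)) = 0" if "i < k" for i
      using Cons.IH[of "?a i"] sum_a[OF that] less by simp
    moreover have "E k \<beta> c ys (?N a) = 0"
      using Cons.IH[of a] less by simp
    ultimately show "E k \<beta> c (y # ys) (?N a) = 0"
      unfolding step by simp
  next
    assume eq: "(\<Sum>i<k. a i) + length (y # ys) = (\<Sum>i<k. c i)"
    let ?M = "length ys"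
    \<comment> \<open>Keeping all indices leaves one operator too few, so the first half of the
      induction hypothesis removes the scalar term.\<close>
    have "E k \<beta> c ys (?N a) = 0"
      using Cons.IH[of a] eq by simp
    then have "(\<Prod>i<k. fact (c i)) * E k \<beta> c (y # ys) (?N a) =
        (\<Sum>i<k. (\<Prod>i<k. fact (c i)) * E k \<beta> c ys (?N (?a i)))"
      unfolding step by (simp add: sum_distrib_left)
    also have "\<dots> = (\<Sum>i<k. fact ?M * falling_form k c (?a i))"
    proof (intro sum.cong refl)
      fix i assume "i \<in> {..<k}"
      then show "(\<Prod>i<k. fact (c i)) * E k \<beta> c ys (?N (?a i)) = fact ?M * falling_form k c (?a i)"
        using Cons.IH[of "?a i"] sum_a[of i] eq by simp
    qed
    also have "\<dots> = fact ?M * (\<Sum>\<sigma> | \<sigma> permutes {..<k}. \<Sum>i<k. sign \<sigma> * (\<Prod>l<k. falling (c (\<sigma> l)) (?a i l)))"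
      by (subst sum.swap) (simp add: sum_distrib_left)
    also have "(\<Sum>\<sigma> | \<sigma> permutes {..<k}. \<Sum>i<k. sign \<sigma> * (\<Prod>l<k. falling (c (\<sigma> l)) (?a i l))) =
       (\<Sum>\<sigma> | \<sigma> permutes {..<k}. (1 + int ?M) * (sign \<sigma> * (\<Prod>l<k. falling (c (\<sigma> l)) (a l))))"
    proof (intro sum.cong refl)
      fix \<sigma> assume "\<sigma> \<in> {\<sigma>. \<sigma> permutes {..<k}}"
      then have \<sigma>: "\<sigma> permutes {..<k}" by simp
      have "(\<Prod>l<k. falling (c (\<sigma> l)) (?a i l)) =
          (int (c (\<sigma> i)) - int (a i)) * (\<Prod>l<k. falling (c (\<sigma> l)) (a l))" if "i < k" for i
        using that by (simp add: prod.remove[of "{..<k}" i] falling_Suc)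
      then have "(\<Sum>i<k. sign \<sigma> * (\<Prod>l<k. falling (c (\<sigma> l)) (?a i l))) =
         (\<Sum>i<k. sign \<sigma> * ((int (c (\<sigma> i)) - int (a i)) * (\<Prod>l<k. falling (c (\<sigma> l)) (a l))))"
        by (intro sum.cong) auto
      also have "\<dots> = (\<Sum>i<k. int (c (\<sigma> i)) - int (a i)) * (sign \<sigma> * (\<Prod>l<k. falling (c (\<sigma> l)) (a l)))"
        unfolding sum_distrib_right by (intro sum.cong refl) (rule mult.left_commute)
      \<comment> \<open>The total deficit is the same for every permutation and supplies the next
        factor of the factorial.\<close>
      also have "(\<Sum>i<k. int (c (\<sigma> i)) - int (a i)) = 1 + int ?M"
        using eq sum_compose_permutes[OF \<sigma>, of "\<lambda>i. int (c i)"]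
        by (simp add: sum_subtractf of_nat_sum[symmetric] del: of_nat_sum)
      finally show "(\<Sum>i<k. sign \<sigma> * (\<Prod>l<k. falling (c (\<sigma> l)) (?a i l))) =
         (1 + int ?M) * (sign \<sigma> * (\<Prod>l<k. falling (c (\<sigma> l)) (a l)))" .
    qed
    also have "fact ?M * \<dots> = fact (length (y # ys)) * falling_form k c a"
      by (simp add: sum_distrib_left algebra_simps)
    finally show "(\<Prod>i<k. fact (c i)) * E k \<beta> c (y # ys) (?N a) =
        fact (length (y # ys)) * falling_form k c a" .
  qed
qed

text \<open>The entries are values of monic polynomials at the points \<open>c j\<close>. Passing to
  Newton polynomials with nodes \<open>c\<close> keeps the determinant and makes the matrix
  triangular.\<close>

lemma falling_form_id:
  "falling_form k c (\<lambda>i. i) = (\<Prod>i<k. \<Prod>l<i. int (c i) - int (c l))"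
proof -
  define W where "W = leibniz_form k (\<lambda>j u. poly u (int (c j)))"
  have W: "alternating_form k W"
    unfolding W_def by (rule alternating_form_leibniz_form) auto
  have "falling_form k c (\<lambda>i. i) = W (newton_poly int)"
    by (simp add: W_def leibniz_form_def falling_def)
  also have "\<dots> = W (\<lambda>i. if i < k then newton_poly (\<lambda>l. int (c l)) i else newton_poly int i)"
    by (rule alternating_form_monic_cong[OF W]) (auto simp: degree_newton_poly)
  also have "\<dots> = (\<Sum>\<sigma> | \<sigma> permutes {..<k}. if \<sigma> = id then (\<Prod>i<k. \<Prod>l<i. int (c i) - int (c l)) else 0)"
    unfolding W_def leibniz_form_def
  proof (intro sum.cong refl)
    fix \<sigma> assume "\<sigma> \<in> {\<sigma>. \<sigma> permutes {..<k}}"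
    then have \<sigma>: "\<sigma> permutes {..<k}" by simp
    show "sign \<sigma> * (\<Prod>i<k. poly (if i < k then newton_poly (\<lambda>l. int (c l)) i else newton_poly int i) (int (c (\<sigma> i)))) =
       (if \<sigma> = id then (\<Prod>i<k. \<Prod>l<i. int (c i) - int (c l)) else 0)"
    proof (cases "\<sigma> = id")
      case True
      then show ?thesis by (simp add: poly_newton_poly)
    next
      case False
      \<comment> \<open>Every permutation other than the identity lowers some index
        \<open>i\<close>, and the \<open>i\<close>-th Newton polynomial vanishes at all earlier
        nodes.\<close>
      then obtain i where i: "i < k" "\<sigma> i < i"
        using permutes_natset_ge[OF \<sigma>] by (metis lessThan_iff not_le)
      then have "poly (newton_poly (\<lambda>l. int (c l)) i) (int (c (\<sigma> i))) = 0"
        by (auto simp: poly_newton_poly)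
      then have "(\<Prod>i<k. poly (if i < k then newton_poly (\<lambda>l. int (c l)) i else newton_poly int i) (int (c (\<sigma> i)))) = 0"
        using i by (intro prod_zero) (auto intro!: bexI[of _ i])
      then show ?thesis using False by simp
    qed
  qed
  also have "\<dots> = (\<Prod>i<k. \<Prod>l<i. int (c i) - int (c l))"
    by (subst sum.delta) (auto simp: permutes_id finite_permutations)
  finally show ?thesis .
qed

section \<open>Nilpotency on the primary components\<close>

lemma int_dvd_diff_imp_eq:
  assumes "int q dvd int v - int w" "v < q" "w < q"
  shows "v = w"
proof -
  have "int v mod int q = int w mod int q"
    using assms(1) by (simp only: mod_eq_dvd_iff)
  then show ?thesis using assms(2,3) by simp
qed

definition root_poly :: "nat multiset \<Rightarrow> int poly" where
  "root_poly S = (\<Prod>b\<in>#S. [:- int b, 1:])"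

lemma root_poly_add_mset: "root_poly (add_mset b S) = [:- int b, 1:] * root_poly S"
  by (simp add: root_poly_def del: mult_pCons_left)

text \<open>\<open>root_poly (B - R)\<close> stands for P / R with P the product over
  \<open>B\<close>; a linear factor cancels one root of \<open>R\<close>. The inclusion in
  \<open>B\<close> matters because multiset difference truncates.\<close>

lemma root_poly_remove:
  assumes "R \<subseteq># B" "b \<in># R"
  shows "root_poly (B - (R - {#b#})) = [:- int b, 1:] * root_poly (B - R)"
proof -
  have "B - (R - {#b#}) = add_mset b (B - R)"
  proof (rule multiset_eqI)
    fix x
    have "count R x \<le> count B x" "0 < count R b"
      using assms by (simp_all add: mset_subset_eq_count)
    then show "count (B - (R - {#b#})) x = count (add_mset b (B - R)) x" by auto
  qed
  then show ?thesis by (simp add: root_poly_add_mset del: mult_pCons_left)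
qed

lemma X_mult_root_poly:
  assumes "R \<subseteq># B" "b \<in># R"
  shows "[:0, 1:] * root_poly (B - R) = root_poly (B - (R - {#b#})) + smult (int b) (root_poly (B - R))"
  unfolding root_poly_remove[OF assms] by simp

section \<open>Extremal sums of distinct exponents\<close>

abbreviation fiber_card :: "nat \<Rightarrow> (nat \<Rightarrow> nat) \<Rightarrow> nat \<Rightarrow> nat" where
  "fiber_card k b v \<equiv> card {i. i < k \<and> b i = v}"

lemma sum_lessThan_fibers: "(\<Sum>i<k. f i) = (\<Sum>v\<in>b ` {..<k}. \<Sum>i | i < k \<and> b i = v. f i)"
  for f :: "nat \<Rightarrow> nat"
  using sum.group[of "{..<k}" "b ` {..<k}" b f] by simp

lemma sum_distinct_ge:
  fixes k :: nat and b j :: "nat \<Rightarrow> nat"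
  assumes "\<And>i. i < k \<Longrightarrow> j i \<noteq> 0"
    and dist: "\<And>i l. i < k \<Longrightarrow> l < k \<Longrightarrow> i \<noteq> l \<Longrightarrow> b i = b l \<Longrightarrow> j i \<noteq> j l"
  shows "(\<Sum>v\<in>b ` {..<k}. \<Sum>{0..fiber_card k b v}) \<le> (\<Sum>i<k. j i)"
  unfolding sum_lessThan_fibers[of j k b]
proof (rule sum_mono)
  fix v
  let ?S = "{i. i < k \<and> b i = v}"
  have inj: "inj_on (\<lambda>i. j i - 1) ?S"
  proof (rule inj_onI)
    fix i l assume il: "i \<in> ?S" "l \<in> ?S" "j i - 1 = j l - 1"
    then have "j i \<noteq> 0" "j l \<noteq> 0" using assms(1) by auto
    then have "j i = j l" using il(3) by linarith
    then show "i = l" using dist[of i l] il by auto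
  qed
  have "\<Sum>{0..fiber_card k b v} = \<Sum>{0..<card ?S} + card ?S"
    by (simp add: atLeast0AtMost atLeast0LessThan lessThan_Suc_atMost[symmetric])
  also have "\<Sum>{0..<card ?S} \<le> \<Sum>((\<lambda>i. j i - 1) ` ?S)"
    using card_sum_le_nat_sum[of "(\<lambda>i. j i - 1) ` ?S"] card_image[OF inj] by simp
  also have "\<dots> = (\<Sum>i\<in>?S. j i - 1)"
    by (subst sum.reindex[OF inj]) simp
  also have "(\<Sum>i\<in>?S. j i - 1) + card ?S = (\<Sum>i\<in>?S. (j i - 1) + 1)"
    by (simp only: sum.distrib) simp
  also have "\<dots> = (\<Sum>i\<in>?S. j i)"
    using assms(1) by (intro sum.cong) auto
  finally show "\<Sum>{0..fiber_card k b v} \<le> (\<Sum>i\<in>?S. j i)" by simp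
qed

text \<open>Within a fibre the distances \<open>n v - j i\<close> are distinct, so their sum is at
  least that of 0, 1, 2, .... The second conclusion holds because distinct exponents must fit into
  \<open>{1..n v}\<close>.\<close>

lemma sum_distinct_le:
  fixes k :: nat and b j n :: "nat \<Rightarrow> nat"
  assumes j: "\<And>i. i < k \<Longrightarrow> j i \<noteq> 0 \<and> j i \<le> n (b i)"
    and dist: "\<And>i l. i < k \<Longrightarrow> l < k \<Longrightarrow> i \<noteq> l \<Longrightarrow> b i = b l \<Longrightarrow> j i \<noteq> j l"
  shows "(\<Sum>i<k. j i) \<le> (\<Sum>v\<in>b ` {..<k}. fiber_card k b v * (n v - fiber_card k b v)) +
      (\<Sum>v\<in>b ` {..<k}. \<Sum>{0..fiber_card k b v})"
    and "fiber_card k b v \<le> n v"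
proof -
  let ?S = "\<lambda>v. {i. i < k \<and> b i = v}"
  show le: "fiber_card k b v \<le> n v" for v
  proof -
    have "inj_on j (?S v)"
      using dist by (intro inj_onI) (metis (mono_tags, lifting) mem_Collect_eq)
    moreover have "j ` ?S v \<subseteq> {1..n v}" using j by fastforce
    ultimately show ?thesis using card_inj_on_le[of j "?S v" "{1..n v}"] by simp
  qed
  show "(\<Sum>i<k. j i) \<le> (\<Sum>v\<in>b ` {..<k}. fiber_card k b v * (n v - fiber_card k b v)) +
      (\<Sum>v\<in>b ` {..<k}. \<Sum>{0..fiber_card k b v})"
    unfolding sum_lessThan_fibers[of j k b] sum.distrib[symmetric]
  proof (rule sum_mono)
    fix v
    let ?m = "fiber_card k b v"
    have inj: "inj_on (\<lambda>i. n v - j i) (?S v)"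
    proof (rule inj_onI)
      fix i l assume il: "i \<in> ?S v" "l \<in> ?S v" "n v - j i = n v - j l"
      then have "j i \<le> n v" "j l \<le> n v" using j[of i] j[of l] by auto
      then have "j i = j l" using il(3) by linarith
      then show "i = l" using dist[of i l] il by auto
    qed
    have "\<Sum>{0..<?m} \<le> \<Sum>((\<lambda>i. n v - j i) ` ?S v)"
      using card_sum_le_nat_sum[of "(\<lambda>i. n v - j i) ` ?S v"] card_image[OF inj] by simp
    also have "\<dots> = (\<Sum>i\<in>?S v. n v - j i)"
      by (simp add: sum.reindex[OF inj])
    finally have "\<Sum>{0..<?m} + (\<Sum>i\<in>?S v. j i) \<le> (\<Sum>i\<in>?S v. (n v - j i) + j i)"
      by (simp add: sum.distrib)
    also have "\<dots> = (\<Sum>i\<in>?S v. n v)"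
      using j by (intro sum.cong) auto
    also have "\<dots> = ?m * n v" by simp
    finally have *: "\<Sum>{0..<?m} + (\<Sum>i\<in>?S v. j i) \<le> ?m * n v" .
    \<comment> \<open>Two consecutive triangular numbers add up to a square; this isolates the
      minimal sum of \<open>sum_distinct_ge\<close> in the upper bound.\<close>
    have sq: "\<Sum>{0..<m} + \<Sum>{0..m} = m * m" for m :: nat
      by (induction m) auto
    have "?m * n v = ?m * (n v - ?m) + ?m * ?m"
      using le[of v] by (simp add: add_mult_distrib2[symmetric])
    then show "(\<Sum>i\<in>?S v. j i) \<le> ?m * (n v - ?m) + \<Sum>{0..?m}"
      using * sq[of ?m] by linarith
  qed
qed

text \<open>Modulo \<open>q\<close>, an operator \<open>shift_op k z\<close> with \<open>z = y\<close> lowers one exponent \<open>j i\<close>, and no operator raises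
  any. Once the sum of the exponents is smaller than it can be for distinct pairs \<open>(b i, j i)\<close> with
  \<open>j i > 0\<close>, the form vanishes.\<close>

lemma dvd_foldr_shift_op_pure_aux:
  assumes W: "alternating_form k W" and kill: "kills_multiples k (root_poly B) W"
    and "int q dvd (\<Sum>i<k. int (b i)) - y"
    and "\<And>i. i < k \<Longrightarrow> j i \<le> count B (b i)"
    and "(\<Sum>i<k. j i) < count_list ys y + (\<Sum>v\<in>b ` {..<k}. \<Sum>{0..fiber_card k b v})"
  shows "int q dvd foldr (shift_op k) ys W (\<lambda>i. root_poly (B - replicate_mset (j i) (b i)))"
  using assms(4,5)
proof (induction ys arbitrary: j)
  case Nil
  then have "\<not> (\<Sum>v\<in>b ` {..<k}. \<Sum>{0..fiber_card k b v}) \<le> (\<Sum>i<k. j i)" by simp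
  then consider i where "i < k" "j i = 0" |
      i l where "i < k" "l < k" "i \<noteq> l" "b i = b l" "j i = j l"
    using sum_distinct_ge[of k j b] by blast
  then have "W (\<lambda>i. root_poly (B - replicate_mset (j i) (b i))) = 0"
  proof cases
    case (1 i)
    then show ?thesis by (intro kills_multiplesD[OF kill, of i]) auto
  next
    case (2 i l)
    then show ?thesis by (intro alternating_form_eq[OF W 2(1-3)]) auto
  qed
  then show ?case by simp
next
  case (Cons z ys)
  let ?u = "\<lambda>j i. root_poly (B - replicate_mset (j i) (b i))"
  let ?E = "foldr (shift_op k) ys W"
  show ?case
  proof (cases "\<exists>i<k. j i = 0")
    case True
    then obtain i where i: "i < k" "j i = 0" by blast
    show ?thesis
      by (subst kills_multiplesD[OF kills_multiples_foldr_shift_op[OF kill] i(1)]) (use i in auto)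
  next
    case False
    let ?j = "\<lambda>i. j(i := j i - 1)"
    let ?v = "\<lambda>i. root_poly (B - replicate_mset (j i - 1) (b i))"
    have X: "[:0, 1:] * ?u j i = ?v i + smult (int (b i)) (?u j i)" if "i < k" for i
    proof -
      have "b i \<in># replicate_mset (j i) (b i)" using False that by auto
      moreover have "replicate_mset (j i) (b i) \<subseteq># B"
        using Cons.prems(1)[OF that] by (simp add: count_le_replicate_mset_subset_eq)
      moreover have "replicate_mset (j i) (b i) - {#b i#} = replicate_mset (j i - 1) (b i)"
        using False that by (cases "j i") auto
      ultimately show ?thesis
        using X_mult_root_poly[of "replicate_mset (j i) (b i)" B "b i"] by simp
    qed
    have upd: "(?u j)(i := ?v i) = ?u (?j i)" for i
      by (auto simp: fun_eq_iff)
    have "foldr (shift_op k) (z # ys) W (?u j) =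
        (\<Sum>i<k. ?E (?u (?j i))) + ((\<Sum>i<k. int (b i)) - z) * ?E (?u j)"
      using shift_op_eigen[OF alternating_form_foldr_shift_op[OF W], where u = "?u j", OF X, of z ys]
      by (simp only: foldr.simps o_def upd)
    moreover have "int q dvd (\<Sum>i<k. ?E (?u (?j i)))"
    proof (rule dvd_sum)
      fix i assume "i \<in> {..<k}"
      then have i: "i < k" "j i \<noteq> 0" using False by auto
      \<comment> \<open>The exponent sum drops by one, which pays for a possible occurrence of
        \<open>y\<close> at the head of the list.\<close>
      have "(\<Sum>l<k. j l) = Suc (\<Sum>l<k. ?j i l)"
        using i by (simp add: sum.remove[of "{..<k}" i])
      moreover have "?j i l \<le> count B (b l)" if "l < k" for l
        using Cons.prems(1)[OF that] by (cases "l = i") auto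
      ultimately show "int q dvd ?E (?u (?j i))"
        using Cons.prems(2) by (intro Cons.IH) (auto split: if_splits)
    qed
    moreover have "int q dvd ((\<Sum>i<k. int (b i)) - z) * ?E (?u j)"
    proof (cases "z = y")
      case True
      then show ?thesis using assms(3) by simp
    next
      case False
      \<comment> \<open>Dropping a \<open>z\<close> different from \<open>y\<close> leaves
        \<open>count_list\<close> unchanged, so the same exponents remain admissible.\<close>
      then have "int q dvd ?E (?u j)"
        using Cons.prems by (intro Cons.IH) auto
      then show ?thesis by simp
    qed
    ultimately show ?thesis by simp
  qed
qed

text \<open>For distinct pairs with positive exponents, the largest and smallest possible exponent
  sums differ by the bound in \<open>ys\<close>, so the operators at \<open>y\<close> outnumber the
  steps available. In all other configurations the form vanishes outright.\<close>

lemma dvd_foldr_shift_op_pure: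
  assumes W: "alternating_form k W" and kill: "kills_multiples k (root_poly B) W"
    and le: "\<And>i. i < k \<Longrightarrow> j i \<le> count B (b i)"
    and ys: "(\<And>v. fiber_card k b v \<le> count B v) \<Longrightarrow>
      \<exists>y. int q dvd (\<Sum>i<k. int (b i)) - y \<and>
        (\<Sum>v\<in>b ` {..<k}. fiber_card k b v * (count B v - fiber_card k b v)) < count_list ys y"
  shows "int q dvd foldr (shift_op k) ys W (\<lambda>i. root_poly (B - replicate_mset (j i) (b i)))"
proof -
  consider i where "i < k" "j i = 0" |
      i l where "i < k" "l < k" "i \<noteq> l" "b i = b l" "j i = j l" |
      "\<forall>i<k. j i \<noteq> 0" "\<forall>i<k. \<forall>l<k. i \<noteq> l \<longrightarrow> b i = b l \<longrightarrow> j i \<noteq> j l"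
    by blast
  then show ?thesis
  proof cases
    case (1 i)
    then show ?thesis
      by (subst kills_multiplesD[OF kills_multiples_foldr_shift_op[OF kill] 1(1)]) auto
  next
    case (2 i l)
    then show ?thesis
      by (subst alternating_form_eq[OF alternating_form_foldr_shift_op[OF W] 2(1-3)]) auto
  next
    case 3
    have bound: "(\<Sum>i<k. j i) \<le> (\<Sum>v\<in>b ` {..<k}. fiber_card k b v * (count B v - fiber_card k b v)) +
        (\<Sum>v\<in>b ` {..<k}. \<Sum>{0..fiber_card k b v})"
      by (rule sum_distinct_le) (use 3 le in auto)
    have "fiber_card k b v \<le> count B v" for v
      by (rule sum_distinct_le(2)[where j = j]) (use 3 le in auto)
    from ys[OF this] obtain y where y: "int q dvd (\<Sum>i<k. int (b i)) - y"
        "(\<Sum>v\<in>b ` {..<k}. fiber_card k b v * (count B v - fiber_card k b v)) < count_list ys y"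
      by blast
    show ?thesis
      by (rule dvd_foldr_shift_op_pure_aux[OF W kill y(1) le]) (use bound y(2) in auto)
  qed
qed

text \<open>Partial fractions: \<open>P / R\<close> is, up to a unit modulo \<open>q\<close>, the difference of \<open>P / (R / (X - v))\<close>
  and \<open>P / (R / (X - w))\<close> for distinct roots \<open>v\<close>, \<open>w\<close> of \<open>R\<close>, which reduces to the case that each
  \<open>R\<close> has a single root.\<close>

lemma dvd_foldr_shift_op:
  assumes W: "alternating_form k W" and kill: "kills_multiples k (root_poly B) W"
    and "prime q" and B: "\<And>v. v \<in># B \<Longrightarrow> v < q"
    and ys: "\<And>b. (\<And>v. fiber_card k b v \<le> count B v) \<Longrightarrow>
      \<exists>y. int q dvd (\<Sum>i<k. int (b i)) - y \<and>
        (\<Sum>v\<in>b ` {..<k}. fiber_card k b v * (count B v - fiber_card k b v)) < count_list ys y"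
    and "\<And>i. R i \<subseteq># B" and "\<And>i. i \<ge> k \<Longrightarrow> R i = {#}"
  shows "int q dvd foldr (shift_op k) ys W (\<lambda>i. root_poly (B - R i))"
  using assms(6,7)
proof (induction "\<Sum>i<k. size (R i)" arbitrary: R rule: less_induct)
  case less
  let ?E = "foldr (shift_op k) ys W"
  have E: "alternating_form k ?E" by (rule alternating_form_foldr_shift_op[OF W])
  let ?u = "\<lambda>R i. root_poly (B - R i)"
  show ?case
  proof (cases "\<exists>i<k. \<exists>v w. v \<in># R i \<and> w \<in># R i \<and> v \<noteq> w")
    case True
    then obtain i v w where i: "i < k" and vw: "v \<in># R i" "w \<in># R i" "v \<noteq> w" by blast
    have IH: "int q dvd ?E ((?u R)(i := [:- int x, 1:] * ?u R i))" if "x \<in># R i" for x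
    proof -
      let ?R = "R(i := R i - {#x#})"
      have "(\<Sum>l<k. size (R l)) = Suc (\<Sum>l<k. size (?R l))"
        using i size_Suc_Diff1[OF that] by (simp add: sum.remove[of "{..<k}" i])
      moreover have "?R l \<subseteq># B" for l
        using less.prems(1)[of l] by (cases "l = i") (auto intro: subset_mset.order_trans[OF diff_subset_eq_self])
      ultimately have "int q dvd ?E (?u ?R)"
        using less.prems(2) i by (intro less.hyps) auto
      moreover have "?u ?R = (?u R)(i := [:- int x, 1:] * ?u R i)"
        using root_poly_remove[OF less.prems(1) that] by (auto simp: fun_eq_iff)
      ultimately show ?thesis by simp
    qed
    have eq: "[:- int v, 1:] * ?u R i - [:- int w, 1:] * ?u R i = smult (int w - int v) (?u R i)"
      by (simp add: algebra_simps smult_diff_left)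
    have "?E ((?u R)(i := [:- int v, 1:] * ?u R i)) - ?E ((?u R)(i := [:- int w, 1:] * ?u R i)) =
        (int w - int v) * ?E (?u R)"
      unfolding alternating_form_diff[OF E i, symmetric] eq alternating_form_smult[OF E i]
      using fun_upd_triv[of "?u R" i] by (simp only:)
    then have "int q dvd (int w - int v) * ?E (?u R)"
      using dvd_diff[OF IH[OF vw(1)] IH[OF vw(2)]] by simp
    moreover have "\<not> int q dvd int w - int v"
    proof
      assume "int q dvd int w - int v"
      moreover have "v < q" "w < q" using B vw less.prems(1) by (meson mset_subset_eqD)+
      ultimately show False using int_dvd_diff_imp_eq[of q w v] vw(3) by simp
    qed
    ultimately show ?thesis
      using \<open>prime q\<close> by (simp add: prime_dvd_mult_iff)
  next
    case False
    \<comment> \<open>The default 0 covers empty \<open>R i\<close>. It may enlarge the fibre of 0,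
      but then an exponent is 0 and the form vanishes.\<close>
    define b where "b i = (if R i = {#} then 0 else (SOME v. v \<in># R i))" for i
    have R: "R i = replicate_mset (size (R i)) (b i)" for i
    proof (cases "R i = {#}")
      case nonempty: False
      then have "b i \<in># R i"
        unfolding b_def by (auto intro: someI)
      moreover have "i < k" using nonempty less.prems(2) by (meson not_le)
      ultimately have "set_mset (R i) \<subseteq> {b i}"
        using False by blast
      then show ?thesis by (rule set_mset_subset_singletonD)
    qed simp
    have "int q dvd ?E (\<lambda>i. root_poly (B - replicate_mset (size (R i)) (b i)))"
    proof (rule dvd_foldr_shift_op_pure[OF W kill _ ys])
      fix i
      show "size (R i) \<le> count B (b i)"
        using R[of i] less.prems(1)[of i] by (metis count_le_replicate_mset_subset_eq)
    qed
    then show ?thesis by (simp flip: R)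
  qed
qed

section \<open>Restricted sums in a cyclic group of prime order, with multiplicities\<close>

lemma sum_truncated: "(\<Sum>t<k. min d (M - d * t)) = min M (k * d)" for M d :: nat
proof (induction k)
  case (Suc k)
  have "min M (k * d) + min d (M - d * k) = min M (Suc k * d)"
    by (cases "M \<le> k * d") (auto simp: mult.commute min_def)
  then show ?case using Suc by simp
qed simp

text \<open>The indices 0, ..., k - 1 are raised by at most \<open>d\<close> each, the highest
  first, until the total rise is \<open>M\<close>; this order keeps them distinct.\<close>

lemma exists_exponents:
  assumes "M \<le> k * d"
  obtains c :: "nat \<Rightarrow> nat" where "inj_on c {..<k}" "\<And>j. j < k \<Longrightarrow> c j < k + d"
    "(\<Sum>j<k. c j) = (\<Sum>j<k. j) + M"
proof -
  define c where "c j = j + min d (M - d * (k - Suc j))" for j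
  have mono: "c i < c j" if "i < j" for i j
  proof -
    have "d * (k - Suc j) \<le> d * (k - Suc i)"
      using that by (intro mult_le_mono2) auto
    then have "M - d * (k - Suc i) \<le> M - d * (k - Suc j)"
      by (intro diff_le_mono2)
    then have "min d (M - d * (k - Suc i)) \<le> min d (M - d * (k - Suc j))"
      by (intro min.mono) auto
    then show ?thesis unfolding c_def using that by linarith
  qed
  show ?thesis
  proof
    show "inj_on c {..<k}"
      by (intro inj_onI) (metis linorder_neqE_nat mono nat_neq_iff)
    show "c j < k + d" if "j < k" for j
      using that unfolding c_def by linarith
    have "(\<Sum>j<k. min d (M - d * (k - Suc j))) = (\<Sum>t<k. min d (M - d * t))"
      by (rule sum.nat_diff_reindex)
    then show "(\<Sum>j<k. c j) = (\<Sum>j<k. j) + M"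
      unfolding c_def using assms by (simp add: sum.distrib sum_truncated)
  qed
qed

text \<open>Taking the roots as nodes links the two descriptions of the initial vector, by Newton
  polynomials and by partial products of P.\<close>

lemma newton_poly_nth:
  "i \<le> length bs \<Longrightarrow> newton_poly (\<lambda>l. int (bs ! l)) i = root_poly (mset (take i bs))"
proof (induction i)
  case (Suc i)
  then show ?case
    by (simp add: take_Suc_conv_app_nth root_poly_add_mset newton_poly_def mult.commute
        del: mult_pCons_left mult_pCons_right)
qed (simp add: root_poly_def)

lemma prime_not_dvd_falling_form:
  assumes "prime q" "inj_on c {..<k}" "\<And>j. j < k \<Longrightarrow> c j < q"
  shows "\<not> int q dvd falling_form k c (\<lambda>i. i)"
proof
  assume "int q dvd falling_form k c (\<lambda>i. i)"
  then have "int q dvd (\<Prod>i<k. \<Prod>l<i. int (c i) - int (c l))"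
    by (simp only: falling_form_id)
  then obtain i l where il: "i < k" "l < i" "int q dvd int (c i) - int (c l)"
    using \<open>prime q\<close> by (auto simp: prime_dvd_prod_iff)
  then have "c i = c l"
    using assms(3)[of i] assms(3)[of l] il by (intro int_dvd_diff_imp_eq[OF il(3)]) auto
  then show False
    using assms(2) il by (auto dest: inj_onD)
qed

text \<open>Here \<open>n v\<close> is the number of elements of \<open>A\<close> in the \<open>v\<close>-th coset of a subgroup of prime
  index \<open>q\<close>, and \<open>m y\<close> the number of elements of the restricted sumset in the \<open>y\<close>-th coset.\<close>

theorem multiset_Dias_da_Silva_Hamidoune:
  fixes n m :: "nat \<Rightarrow> nat"
  assumes "prime q" and N: "(\<Sum>v<q. n v) = N" "N \<le> q" and "k \<le> N"
    and m: "\<And>\<kappa>. (\<And>v. v < q \<Longrightarrow> \<kappa> v \<le> n v) \<Longrightarrow> (\<Sum>v<q. \<kappa> v) = k \<Longrightarrow>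
      (\<Sum>v<q. \<kappa> v * (n v - \<kappa> v)) < m ((\<Sum>v<q. \<kappa> v * v) mod q)"
  shows "min q (k * (N - k) + 1) \<le> (\<Sum>y<q. m y)"
proof (rule ccontr)
  assume "\<not> ?thesis"
  then have small: "(\<Sum>y<q. m y) < q" "(\<Sum>y<q. m y) \<le> k * (N - k)" by auto
  have "q > 0" using \<open>prime q\<close> by (simp add: prime_gt_0_nat)
  define B where "B = (\<Sum>v<q. replicate_mset (n v) v)"
  have count_B: "count B v = (if v < q then n v else 0)" for v
    unfolding B_def count_sum count_replicate_mset by (simp add: sum.delta')
  have size_B: "size B = N"
    unfolding B_def using N(1) by (simp add: size_multiset_sum)
  obtain bs where bs: "mset bs = B" using ex_mset by blast
  then have len_bs: "length bs = N" using size_B by (metis size_mset)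
  define \<beta> where "\<beta> l = int (bs ! l)" for l
  have newton: "newton_poly \<beta> i = root_poly (B - mset (drop i bs))" if "i \<le> N" for i
  proof -
    have "mset (take i bs) = B - mset (drop i bs)"
      using bs by (metis add_diff_cancel_right' append_take_drop_id mset_append)
    then show ?thesis
      using newton_poly_nth[of i bs] that len_bs unfolding \<beta>_def by simp
  qed
  \<comment> \<open>The cap \<open>q - 1\<close> keeps \<open>fact M\<close> prime to
    \<open>q\<close>, and the other cap leaves room for indices \<open>c\<close> below
    \<open>N\<close>. The negated claim says precisely that \<open>m\<close> sums to at most
    \<open>M\<close>.\<close>
  define M where "M = min (q - 1) (k * (N - k))"
  have M: "(\<Sum>y<q. m y) \<le> M" "M < q" "M \<le> k * (N - k)"
    using small \<open>q > 0\<close> by (auto simp: M_def)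
  obtain c where c: "inj_on c {..<k}" "\<And>j. j < k \<Longrightarrow> c j < N"
      "(\<Sum>j<k. c j) = (\<Sum>j<k. j) + M"
    using exists_exponents[OF M(3)] \<open>k \<le> N\<close> by auto
  \<comment> \<open>Each \<open>y\<close> occurs \<open>m y\<close> times; zeros pad the list to
    length exactly \<open>M\<close>, which can only increase the counts.\<close>
  define Y where "Y = (\<Sum>y<q. replicate_mset (m y) (int y)) + replicate_mset (M - (\<Sum>y<q. m y)) 0"
  obtain ys where ys: "mset ys = Y" using ex_mset by blast
  have "size Y = M"
    unfolding Y_def using M(1) by (simp add: size_multiset_sum)
  then have len_ys: "length ys = M"
    using ys by (metis size_mset)
  have count_ys: "m y \<le> count_list ys (int y)" if "y < q" for y
  proof -
    have "count Y (int y) \<ge> m y"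
      unfolding Y_def using that by (simp add: count_sum)
    then show ?thesis
      using ys by (metis count_mset)
  qed
  define W where "W = newton_form k \<beta> c"
  have W: "alternating_form k W"
    unfolding W_def by (rule alternating_form_newton_form)
  have kill: "kills_multiples k (root_poly B) W"
    using kills_multiples_newton_form[of k c N \<beta>] c(2) newton[of N] len_bs
    by (simp add: W_def)
  define R where "R i = (if i < k then mset (drop i bs) else {#})" for i
  \<comment> \<open>The index \<open>N\<close> beyond \<open>k\<close> matches the empty
    \<open>R i\<close>: both yield the full product over \<open>B\<close>.\<close>
  define a where "a i = (if i < k then i else N)" for i
  define E where "E = foldr (shift_op k) ys W (\<lambda>i. newton_poly \<beta> (a i))"
  have "(\<lambda>i. newton_poly \<beta> (a i)) = (\<lambda>i. root_poly (B - R i))"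
    using newton \<open>k \<le> N\<close> len_bs by (auto simp: fun_eq_iff a_def R_def)
  moreover have "int q dvd foldr (shift_op k) ys W (\<lambda>i. root_poly (B - R i))"
  proof (rule dvd_foldr_shift_op[OF W kill \<open>prime q\<close>])
    show "v < q" if "v \<in># B" for v
      using that count_B[of v] by (auto simp: count_eq_zero_iff split: if_splits)
    show "R i \<subseteq># B" for i
      unfolding R_def using bs by (auto simp: mset_subset_eq_exists_conv)
         (metis append_take_drop_id mset_append add.commute)
    show "R i = {#}" if "k \<le> i" for i
      using that by (simp add: R_def)
    fix b :: "nat \<Rightarrow> nat"
    assume le: "\<And>v. fiber_card k b v \<le> count B v"
    have b: "b i < q" if "i < k" for i
    proof -
      have "0 < fiber_card k b (b i)" using that by (auto simp: card_gt_0_iff)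
      then show ?thesis using le[of "b i"] count_B[of "b i"] by (auto split: if_splits)
    qed
    have zero: "fiber_card k b v = 0" if "v \<notin> b ` {..<k}" for v
      using that by auto
    have sum_b: "(\<Sum>v<q. fiber_card k b v * g v) = (\<Sum>i<k. g (b i))" for g :: "nat \<Rightarrow> nat"
    proof -
      have "(\<Sum>i<k. g (b i)) = (\<Sum>v<q. \<Sum>i | i \<in> {..<k} \<and> b i = v. g (b i))"
        using b by (intro sum.group[symmetric]) auto
      also have "\<dots> = (\<Sum>v<q. fiber_card k b v * g v)"
        by (intro sum.cong) auto
      finally show ?thesis by simp
    qed
    let ?y = "(\<Sum>v<q. fiber_card k b v * v) mod q"
    have "(\<Sum>v<q. fiber_card k b v * (n v - fiber_card k b v)) < m ?y"
    proof (rule m)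
      show "fiber_card k b v \<le> n v" if "v < q" for v
        using le[of v] count_B[of v] that by simp
      show "(\<Sum>v<q. fiber_card k b v) = k"
        using sum_b[of "\<lambda>_. 1"] by simp
    qed
    also have "m ?y \<le> count_list ys (int ?y)"
      using \<open>q > 0\<close> by (intro count_ys) auto
    also have "(\<Sum>v<q. fiber_card k b v * (n v - fiber_card k b v)) =
        (\<Sum>v<q. fiber_card k b v * (count B v - fiber_card k b v))"
      by (intro sum.cong) (auto simp: count_B)
    also have "\<dots> = (\<Sum>v\<in>b ` {..<k}. fiber_card k b v * (count B v - fiber_card k b v))"
      using b zero by (intro sum.mono_neutral_right) auto
    finally have "(\<Sum>v\<in>b ` {..<k}. fiber_card k b v * (count B v - fiber_card k b v)) <
        count_list ys (int ?y)" .
    moreover have "int q dvd (\<Sum>i<k. int (b i)) - int ?y"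
      using sum_b[of "\<lambda>v. v"] by (simp add: zmod_int dvd_minus_mod flip: of_nat_sum)
    ultimately show "\<exists>y. int q dvd (\<Sum>i<k. int (b i)) - y \<and>
        (\<Sum>v\<in>b ` {..<k}. fiber_card k b v * (count B v - fiber_card k b v)) < count_list ys y"
      by blast
  qed
  ultimately have "int q dvd E" by (simp add: E_def)
  \<comment> \<open>The same \<open>E\<close>, now computed in the Newton basis; the right-hand side
    will turn out to be prime to \<open>q\<close>.\<close>
  moreover have "(\<Prod>i<k. fact (c i)) * E = fact M * falling_form k c (\<lambda>i. i)"
  proof -
    have "(\<Sum>i<k. a i) = (\<Sum>i<k. i)" by (simp add: a_def)
    then have "(\<Prod>i<k. fact (c i)) * E = fact M * falling_form k c a"
      using foldr_shift_op_newton[where k = k and ys = ys and \<beta> = \<beta> and c = c and a = a] c(3) len_ys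
      by (simp add: E_def W_def)
    then show ?thesis by (simp add: a_def)
  qed
  ultimately have "int q dvd fact M * falling_form k c (\<lambda>i. i)"
    by (metis dvd_mult)
  then have "int q dvd fact M \<or> int q dvd falling_form k c (\<lambda>i. i)"
    using \<open>prime q\<close> by (simp add: prime_dvd_mult_iff)
  moreover have "\<not> int q dvd fact M"
  proof
    assume "int q dvd fact M"
    then have "int q dvd int (fact M)" by simp
    then have "q dvd fact M" by (simp only: int_dvd_int_iff)
    then show False using \<open>prime q\<close> M(2) by (simp add: prime_dvd_fact_iff)
  qed
  moreover have "\<not> int q dvd falling_form k c (\<lambda>i. i)"
    using c N(2) by (intro prime_not_dvd_falling_form[OF \<open>prime q\<close>]) (auto intro: less_le_trans)
  ultimately show False by blast
qed

section \<open>Abelian groups\<close>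

definition subset_products :: "('a, 'b) monoid_scheme \<Rightarrow> nat \<Rightarrow> 'a set \<Rightarrow> 'a set" where
  "subset_products G k A = {(\<Otimes>\<^bsub>G\<^esub>x\<in>T. x) | T. T \<subseteq> A \<and> finite T \<and> card T = k}"

context comm_group
begin

text \<open>The products of elements of \<open>K\<close> with powers of \<open>g\<close> form a
  subgroup strictly above \<open>K\<close>, hence all of \<open>H\<close>.\<close>

lemma maximal_subgroup_generates:
  assumes K: "subgroup K G" "K \<subset> H" and H: "subgroup H G"
    and max: "\<And>L. subgroup L G \<Longrightarrow> K \<subset> L \<Longrightarrow> L \<subseteq> H \<Longrightarrow> L = H"
    and g: "g \<in> H" "g \<notin> K" and x: "x \<in> H"
  shows "\<exists>n::int. x \<otimes> inv (g [^] n) \<in> K"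
proof -
  have carr [simp]: "g \<in> carrier G" "\<And>z. z \<in> K \<Longrightarrow> z \<in> carrier G"
    using g(1) subgroup.subset[OF H] K(2) by auto
  define L where "L = {z \<otimes> g [^] n | z n. z \<in> K \<and> (n::int) \<in> UNIV}"
  have "subgroup L G"
  proof (rule subgroupI)
    show "L \<subseteq> carrier G" by (auto simp: L_def)
    show "L \<noteq> {}" using subgroup.one_closed[OF K(1)] by (auto simp: L_def)
  next
    fix a assume "a \<in> L"
    then obtain z and n :: int where "a = z \<otimes> g [^] n" "z \<in> K" by (auto simp: L_def)
    then have "inv a = inv z \<otimes> g [^] (- n)"
      by (simp add: inv_mult int_pow_neg)
    then show "inv a \<in> L"
      using subgroup.m_inv_closed[OF K(1) \<open>z \<in> K\<close>] by (auto simp: L_def)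
  next
    fix a b assume "a \<in> L" "b \<in> L"
    then obtain z w and m n :: int where
      "a = z \<otimes> g [^] n" "z \<in> K" "b = w \<otimes> g [^] m" "w \<in> K" by (auto simp: L_def)
    then have "a \<otimes> b = (z \<otimes> w) \<otimes> g [^] (n + m)"
      by (simp add: int_pow_mult m_ac)
    then show "a \<otimes> b \<in> L"
      using subgroup.m_closed[OF K(1) \<open>z \<in> K\<close> \<open>w \<in> K\<close>] by (auto simp: L_def)
  qed
  moreover have "K \<subseteq> L"
  proof
    fix z assume "z \<in> K"
    then show "z \<in> L" unfolding L_def by (intro CollectI exI[of _ z] exI[of _ "0::int"]) simp
  qed
  moreover have "g \<in> L"
    unfolding L_def using subgroup.one_closed[OF K(1)]
    by (intro CollectI exI[of _ \<one>] exI[of _ "1::int"]) (simp add: int_pow_1)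
  moreover have "L \<subseteq> H"
  proof
    fix a assume "a \<in> L"
    then obtain z and n :: int where "a = z \<otimes> g [^] n" "z \<in> K" by (auto simp: L_def)
    moreover have "g [^] n \<in> H"
      using g(1) H by (simp add: int_pow_closed subgroup_int_pow_closed)
    ultimately show "a \<in> H" using K(2) subgroup.m_closed[OF H] by auto
  qed
  ultimately have "L = H" using max g(2) by blast
  then obtain z and n :: int where "x = z \<otimes> g [^] n" "z \<in> K" using x by (auto simp: L_def)
  then have "x \<otimes> inv (g [^] n) = z" by (simp add: m_assoc)
  then show ?thesis using \<open>z \<in> K\<close> by blast
qed

text \<open>\<open>K\<close> is a maximal proper subgroup of \<open>H\<close>, and
  \<open>\<pi>\<close> is the discrete logarithm modulo \<open>K\<close> to a base \<open>g\<close>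
  outside \<open>K\<close>, which realises H/K as the integers modulo \<open>q\<close>.\<close>

lemma exists_prime_index_character:
  assumes fin: "finite (carrier G)" and H: "subgroup H G" "H \<noteq> {\<one>}"
  obtains K q and \<pi> :: "'a \<Rightarrow> nat" where
    "subgroup K G" "K \<subset> H" "prime q" "q dvd order G"
    "\<And>x. x \<in> H \<Longrightarrow> \<pi> x < q"
    "\<And>x y. x \<in> H \<Longrightarrow> y \<in> H \<Longrightarrow> \<pi> (x \<otimes> y) = (\<pi> x + \<pi> y) mod q"
    "\<And>x. x \<in> H \<Longrightarrow> \<pi> x = 0 \<Longrightarrow> x \<in> K"
proof -
  define S where "S = {K. subgroup K G \<and> K \<subset> H}"
  have finH: "finite H" using fin subgroup.subset[OF H(1)] by (rule finite_subset[rotated])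
  have "S \<subseteq> Pow H" by (auto simp: S_def)
  then have "finite S" using finH by (simp add: finite_subset)
  moreover have "{\<one>} \<in> S"
    using H subgroup.one_closed[OF H(1)] triv_subgroup unfolding S_def by auto
  ultimately obtain K where "K \<in> S" and Kmax: "\<And>L. L \<in> S \<Longrightarrow> K \<subseteq> L \<Longrightarrow> K = L"
    using finite_has_maximal[of S] by blast
  then have K: "subgroup K G" "K \<subset> H" by (auto simp: S_def)
  have max: "L = H" if "subgroup L G" "K \<subset> L" "L \<subseteq> H" for L
    using Kmax[of L] that unfolding S_def by blast
  obtain g where g: "g \<in> H" "g \<notin> K" using K(2) by blast
  have gen: "\<exists>n::int. x \<otimes> inv (h [^] n) \<in> K" if "h \<in> H" "h \<notin> K" "x \<in> H" for h x
    by (rule maximal_subgroup_generates[OF K H(1) max that])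
  have carr [simp]: "g \<in> carrier G" "\<And>z. z \<in> H \<Longrightarrow> z \<in> carrier G" "\<And>z. z \<in> K \<Longrightarrow> z \<in> carrier G"
    using g(1) subgroup.subset[OF H(1)] K(2) by auto
  define q where "q = (LEAST i. 0 < i \<and> g [^] (i::nat) \<in> K)"
  have ord: "g [^] order G \<in> K"
    using subgroup.one_closed[OF K(1)] by (simp add: pow_order_eq_1)
  moreover have "0 < order G" using fin by (simp add: order_gt_0_iff_finite)
  ultimately have q: "0 < q" "g [^] q \<in> K"
    using LeastI[of "\<lambda>i. 0 < i \<and> g [^] (i::nat) \<in> K" "order G"] by (auto simp: q_def)
  have q_min: "q \<le> i" if "0 < i" "g [^] i \<in> K" for i :: nat
    using that unfolding q_def by (intro Least_le) auto
  have pow_K: "g [^] n \<in> K \<longleftrightarrow> int q dvd n" for n :: int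
  proof -
    have gq: "g [^] (int q * m) \<in> K" for m
    proof -
      have "g [^] (int q * m) = (g [^] q) [^] m"
        using int_pow_pow[of g "int q" m] by (simp add: int_pow_int)
      then show ?thesis using q(2) K(1) by (simp add: subgroup_int_pow_closed)
    qed
    show ?thesis
    proof
      assume n: "g [^] n \<in> K"
      have "g [^] (n mod int q) = g [^] (n + int q * (- (n div int q)))"
        by (simp add: minus_mult_div_eq_mod[symmetric])
      also have "\<dots> = g [^] n \<otimes> g [^] (int q * (- (n div int q)))"
        by (rule int_pow_mult) simp
      also have "\<dots> \<in> K" using n gq by (rule subgroup.m_closed[OF K(1)])
      finally have *: "g [^] (n mod int q) \<in> K" .
      define i where "i = nat (n mod int q)"
      have i: "int i = n mod int q" "i < q" using q(1) by (simp_all add: i_def nat_less_iff)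
      then have "g [^] i \<in> K" using * by (metis int_pow_int)
      then have "i = 0" using q_min[of i] i(2) by (meson not_gr_zero not_le)
      then show "int q dvd n" using i(1) by (simp add: dvd_eq_mod_eq_0)
    qed (use gq in \<open>auto elim!: dvdE\<close>)
  qed
  \<comment> \<open>For a divisor \<open>r\<close> of \<open>q\<close> other than 1 and
    \<open>q\<close>, the power \<open>g [^] r\<close> would also generate \<open>H\<close> modulo
    \<open>K\<close>; comparing exponents of \<open>g\<close> shows that \<open>r\<close> divides
    1.\<close>
  have "prime q"
  proof (rule ccontr)
    assume "\<not> prime q"
    moreover have "q \<noteq> 1" using q(2) g(2) by auto
    ultimately obtain r where r: "r dvd q" "r \<noteq> 1" "r \<noteq> q"
      using q(1) by (auto simp: prime_nat_iff)
    have "r < q" "0 < r"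
      using dvd_imp_le[OF r(1) q(1)] dvd_pos_nat[OF q(1) r(1)] r(3) by simp_all
    then have "g [^] r \<notin> K" using q_min[of r] by auto
    moreover have "g [^] r \<in> H" using g(1) H(1) by (metis int_pow_int subgroup_int_pow_closed)
    ultimately obtain n :: int where n: "g \<otimes> inv ((g [^] r) [^] n) \<in> K"
      using gen g(1) by blast
    have "g \<otimes> inv ((g [^] r) [^] n) = g [^] (1::int) \<otimes> g [^] (- (int r * n))"
      by (simp add: int_pow_pow int_pow_neg int_pow_1 flip: int_pow_int)
    also have "\<dots> = g [^] (1 - int r * n)"
      by (subst int_pow_mult[symmetric]) auto
    finally have "int q dvd 1 - int r * n" using n pow_K by simp
    moreover have "int r dvd int q" using r(1) by simp
    ultimately have "int r dvd 1 - int r * n" by (rule dvd_trans[rotated])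
    then have "int r dvd 1" by (metis dvd_diff_commute dvd_triv_left zdvd_zdiffD)
    then show False using r(2) by simp
  qed
  \<comment> \<open>The choice is harmless: any two admissible exponents differ by a multiple of
    \<open>q\<close>, as \<open>\<pi>_eq\<close> shows.\<close>
  define \<pi> where "\<pi> x = nat ((SOME n::int. x \<otimes> inv (g [^] n) \<in> K) mod int q)" for x
  have \<pi>_eq: "\<pi> x = nat (n mod int q)" if x: "x \<in> H" and n: "x \<otimes> inv (g [^] n) \<in> K" for x and n :: int
  proof -
    define m where "m = (SOME n::int. x \<otimes> inv (g [^] n) \<in> K)"
    have m: "x \<otimes> inv (g [^] m) \<in> K" unfolding m_def using n by (rule someI)
    have "inv (x \<otimes> inv (g [^] m)) \<otimes> (x \<otimes> inv (g [^] n)) = g [^] m \<otimes> inv (g [^] n)"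
      using x by (simp add: inv_mult m_ac) (simp add: m_assoc[symmetric])
    also have "\<dots> = g [^] (m - n)" by (simp add: int_pow_diff)
    finally have "g [^] (m - n) \<in> K"
      using subgroup.m_closed[OF K(1) subgroup.m_inv_closed[OF K(1) m] n] by simp
    then have "m mod int q = n mod int q" by (simp add: pow_K mod_eq_dvd_iff)
    then show ?thesis unfolding \<pi>_def m_def[symmetric] by simp
  qed
  show ?thesis
  proof
    show "subgroup K G" "K \<subset> H" "prime q" by fact+
    have "int q dvd int (order G)"
      using ord pow_K[of "int (order G)"] by (simp add: int_pow_int)
    then show "q dvd order G" by simp
    show "\<pi> x < q" for x
      unfolding \<pi>_def using q(1) by (simp add: nat_less_iff)
  next
    fix x y assume x: "x \<in> H" and y: "y \<in> H"
    obtain m n :: int where m: "x \<otimes> inv (g [^] m) \<in> K" and n: "y \<otimes> inv (g [^] n) \<in> K"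
      using gen[OF g x] gen[OF g y] by blast
    have "(x \<otimes> y) \<otimes> inv (g [^] (m + n)) = (x \<otimes> inv (g [^] m)) \<otimes> (y \<otimes> inv (g [^] n))"
      using x y by (simp add: int_pow_mult inv_mult m_ac)
    then have "(x \<otimes> y) \<otimes> inv (g [^] (m + n)) \<in> K"
      using subgroup.m_closed[OF K(1) m n] by simp
    then have "\<pi> (x \<otimes> y) = nat ((m + n) mod int q)"
      by (rule \<pi>_eq[OF subgroup.m_closed[OF H(1) x y]])
    moreover have "\<pi> x = nat (m mod int q)" "\<pi> y = nat (n mod int q)"
      by (rule \<pi>_eq[OF x m], rule \<pi>_eq[OF y n])
    moreover have "int ((nat (m mod int q) + nat (n mod int q)) mod q) = (m + n) mod int q"
      using q(1) by (simp add: zmod_int mod_add_eq)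
    ultimately show "\<pi> (x \<otimes> y) = (\<pi> x + \<pi> y) mod q" by (metis nat_int)
  next
    fix x assume x: "x \<in> H" "\<pi> x = 0"
    obtain m :: int where m: "x \<otimes> inv (g [^] m) \<in> K"
      using gen[OF g x(1)] by blast
    then have "nat (m mod int q) = 0" using \<pi>_eq x by metis
    then have "int q dvd m"
      using q(1) pos_mod_sign[of "int q" m] by (simp add: dvd_eq_mod_eq_0 order_antisym_conv)
    then have "g [^] m \<in> K" by (simp add: pow_K)
    from subgroup.m_closed[OF K(1) m this] show "x \<in> K"
      using x(1) by (simp add: m_assoc)
  qed
qed

section \<open>Products of two sets and the Cauchy-Davenport bound\<close>

lemma le_ord:
  assumes fin: "finite (carrier G)" and p: "\<And>r. prime r \<Longrightarrow> r dvd order G \<Longrightarrow> p \<le> r"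
    and d: "d \<in> carrier G" "d \<noteq> \<one>"
  shows "p \<le> ord d"
proof -
  have "ord d \<noteq> 1" using d ord_eq_1[of d] by simp
  then obtain r where r: "prime r" "r dvd ord d" using prime_factor_nat by blast
  then have "p \<le> r" using ord_dvd_group_order[OF d(1)] by (intro p) (auto intro: dvd_trans)
  also have "r \<le> ord d"
    using r(2) ord_ge_1[OF fin d(1)] by (intro dvd_imp_le) auto
  finally show ?thesis .
qed

text \<open>Dyson's transform \<open>X \<union> g Y\<close>, \<open>Y \<inter> g\<^sup>-\<^sup>1 X\<close>; if it never shrinks \<open>Y\<close>, then \<open>X\<close> is stable under
  a nontrivial element and hence large.\<close>

lemma Cauchy_Davenport:
  assumes fin: "finite (carrier G)" and p: "\<And>r. prime r \<Longrightarrow> r dvd order G \<Longrightarrow> p \<le> r"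
    and "X \<subseteq> carrier G" "X \<noteq> {}" "Y \<subseteq> carrier G" "Y \<noteq> {}"
  shows "min p (card X + card Y - 1) \<le> card (X <#> Y)"
  using assms(3-)
proof (induction "card Y" arbitrary: X Y rule: less_induct)
  case less
  note carr = subsetD[OF less.prems(1)] subsetD[OF less.prems(3)]
  have finXY: "finite X" "finite Y"
    using less.prems fin by (auto intro: finite_subset)
  have fin_mult: "finite (X <#> Y)"
    using fin set_mult_closed[OF less.prems(1,3)] by (rule finite_subset[rotated])
  obtain y1 where y1: "y1 \<in> Y" using less.prems by blast
  have card_X: "card X \<le> card (X <#> Y)"
  proof (rule card_inj_on_le[OF _ _ fin_mult])
    show "inj_on (\<lambda>x. x \<otimes> y1) X"
      using carr y1 by (auto simp: inj_on_def)
    show "(\<lambda>x. x \<otimes> y1) ` X \<subseteq> X <#> Y"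
      using y1 by (auto simp: set_mult_def)
  qed
  consider "Y = {y1}" | y2 where "y2 \<in> Y" "y2 \<noteq> y1" using y1 by blast
  then show ?case
  proof cases
    case 1
    then show ?thesis using card_X by simp
  next
    case 2
    show ?thesis
    proof (cases "\<exists>g\<in>carrier G. (\<exists>y\<in>Y. g \<otimes> y \<in> X) \<and> (\<exists>y\<in>Y. g \<otimes> y \<notin> X)")
      case True
      then obtain g where g: "g \<in> carrier G" "\<exists>y\<in>Y. g \<otimes> y \<in> X" "\<exists>y\<in>Y. g \<otimes> y \<notin> X" by blast
      define Y' where "Y' = {y \<in> Y. g \<otimes> y \<in> X}"
      define X' where "X' = X \<union> (\<lambda>y. g \<otimes> y) ` Y"
      have Y': "Y' \<noteq> {}" "Y' \<subset> Y" using g by (auto simp: Y'_def)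
      have "card (X <#> Y) \<ge> card (X' <#> Y')"
      proof (rule card_mono[OF fin_mult], rule subsetI)
        fix z assume "z \<in> X' <#> Y'"
        then obtain a b where ab: "a \<in> X'" "b \<in> Y'" "z = a \<otimes> b" by (auto simp: set_mult_def)
        show "z \<in> X <#> Y"
        proof (cases "a \<in> X")
          case True
          then show ?thesis using ab by (auto simp: set_mult_def Y'_def)
        next
          case False
          then obtain y where y: "y \<in> Y" "a = g \<otimes> y" using ab by (auto simp: X'_def)
          then have "z = (g \<otimes> b) \<otimes> y"
            using ab carr g by (simp add: Y'_def m_ac)
          then show ?thesis using ab y by (auto simp: set_mult_def Y'_def)
        qed
      qed
      moreover have "min p (card X' + card Y' - 1) \<le> card (X' <#> Y')"
        using Y' less.prems finXY g(1) carr
        by (intro less.hyps psubset_card_mono) (auto simp: X'_def)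
      \<comment> \<open>The points removed from \<open>Y\<close> are exactly those whose translates
        are new in \<open>X'\<close>.\<close>
      moreover have "card X' + card Y' = card X + card Y"
      proof -
        have "inj_on (\<lambda>y. g \<otimes> y) Y"
          using carr g by (auto simp: inj_on_def)
        then have inj: "inj_on (\<lambda>y. g \<otimes> y) (Y - Y')" by (rule inj_on_subset) auto
        have "X' = X \<union> (\<lambda>y. g \<otimes> y) ` (Y - Y')" "X \<inter> (\<lambda>y. g \<otimes> y) ` (Y - Y') = {}"
          by (auto simp: X'_def Y'_def)
        then have "card X' = card X + card (Y - Y')"
          using finXY card_image[OF inj] by (simp add: card_Un_disjoint)
        moreover have "card Y' \<le> card Y" using Y' finXY by (intro card_mono) auto
        ultimately show ?thesis
          using Y' finXY by (simp add: card_Diff_subset finite_subset[of Y' Y])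
      qed
      ultimately show ?thesis by simp
    next
      case False
      define d where "d = inv y1 \<otimes> y2"
      have y: "y1 \<in> carrier G" "y2 \<in> carrier G" using carr y1 2 by auto
      then have d: "d \<in> carrier G" by (simp add: d_def)
      have "d \<noteq> \<one>" using y 2(2) unfolding d_def by (metis inv_equality inv_inv inv_closed inv_comm)
      then have "p \<le> ord d" using le_ord[OF fin p d] by blast
      \<comment> \<open>The translate of \<open>Y\<close> that carries \<open>y1\<close> to
        \<open>x\<close> meets \<open>X\<close>, hence lies inside \<open>X\<close>, and it carries
        \<open>y2\<close> to \<open>x \<otimes> d\<close>.\<close>
      have X: "x \<otimes> d \<in> X" if "x \<in> X" for x
      proof -
        have "(x \<otimes> inv y1) \<otimes> y1 \<in> X" using that carr y by (simp add: m_assoc)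
        then have "(x \<otimes> inv y1) \<otimes> y2 \<in> X"
          using False y1 2(1) that carr y by blast
        then show ?thesis using that carr y by (simp add: m_assoc d_def)
      qed
      obtain x where x: "x \<in> X" using less.prems by blast
      have "x \<otimes> d [^] i \<in> X" for i :: nat
        by (induction i) (use X x d carr in \<open>auto simp: m_assoc[symmetric]\<close>)
      then have "(\<lambda>i. x \<otimes> d [^] i) ` {1..ord d} \<subseteq> X" by auto
      moreover have "inj_on (\<lambda>i. x \<otimes> d [^] i) {1..ord d}"
      proof (rule inj_onI)
        fix i j assume ij: "i \<in> {1..ord d}" "j \<in> {1..ord d}" "x \<otimes> d [^] i = x \<otimes> d [^] j"
        then have "d [^] i = d [^] j" using d carr(1)[OF x] by simp
        then show "i = j" using inj_onD[OF ord_inj'[OF d]] ij by blast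
      qed
      ultimately have "ord d \<le> card X"
        using card_inj_on_le[of _ "{1..ord d}" X] finXY(1) by fastforce
      then show ?thesis using card_X \<open>p \<le> ord d\<close> by linarith
    qed
  qed
qed

section \<open>Restricted sums as products over subsets\<close>

lemma restricted_sumset_eq_subset_products:
  assumes "A \<subseteq> carrier G"
  shows "restricted_sumset G k A = subset_products G k A"
proof (rule subset_antisym; rule subsetI)
  fix z assume "z \<in> restricted_sumset G k A"
  then obtain a where a: "z = (\<Otimes>i\<in>{1..k}. a i)" "a \<in> {1..k} \<rightarrow> A" "inj_on a {1..k}"
    by (auto simp: restricted_sumset_def)
  then have "z = (\<Otimes>x\<in>a ` {1..k}. x)"
    using assms by (subst finprod_reindex) auto
  then show "z \<in> subset_products G k A"
    unfolding subset_products_def using a card_image[OF a(3)]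
    by (intro CollectI exI[of _ "a ` {1..k}"]) auto
next
  fix z assume "z \<in> subset_products G k A"
  then obtain T where T: "z = (\<Otimes>x\<in>T. x)" "T \<subseteq> A" "finite T" "card T = k"
    by (auto simp: subset_products_def)
  obtain a where a: "bij_betw a {1..k} T"
    using ex_bij_betw_nat_finite_1[OF T(3)] T(4) by blast
  then have "T = a ` {1..k}" "inj_on a {1..k}" by (auto simp: bij_betw_def)
  then have "z = (\<Otimes>i\<in>{1..k}. a i)"
    unfolding T(1) using T(2) assms by (simp only:) (subst finprod_reindex, auto)
  then show "z \<in> restricted_sumset G k A"
    unfolding restricted_sumset_def using T(2) \<open>T = a ` {1..k}\<close> \<open>inj_on a {1..k}\<close> by blast
qed

lemma finite_subset_products: "finite A \<Longrightarrow> finite (subset_products G k A)"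
  unfolding subset_products_def
  by (rule finite_subset[of _ "(\<lambda>T. \<Otimes>x\<in>T. x) ` Pow A"]) auto

lemma subset_products_closed: "A \<subseteq> carrier G \<Longrightarrow> subset_products G k A \<subseteq> carrier G"
  unfolding subset_products_def by (auto intro!: finprod_closed)

lemma subset_products_nonempty:
  assumes "finite A" "k \<le> card A"
  shows "subset_products G k A \<noteq> {}"
proof -
  obtain T where "T \<subseteq> A" "card T = k" "finite T"
    using obtain_subset_with_card_n[OF assms(2)] by metis
  then show ?thesis unfolding subset_products_def by blast
qed

lemma card_subset_products_le:
  assumes A: "finite A" "A \<subseteq> carrier G" and "B \<union> F \<subseteq> A" "B \<inter> F = {}"
  shows "card (subset_products G j B) \<le> card (subset_products G (j + card F) A)"
proof (rule card_inj_on_le)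
  let ?f = "\<Otimes>x\<in>F. x"
  have fin: "finite B" "finite F" and carr: "B \<subseteq> carrier G" "F \<subseteq> carrier G"
    using assms by (auto intro: finite_subset)
  have f: "?f \<in> carrier G" using carr by (auto intro!: finprod_closed)
  show "inj_on (\<lambda>z. z \<otimes> ?f) (subset_products G j B)"
    using f subset_products_closed[OF carr(1), of j] by (intro inj_onI) (metis right_cancel subsetD)
  show "finite (subset_products G (j + card F) A)" by (rule finite_subset_products[OF A(1)])
  show "(\<lambda>z. z \<otimes> ?f) ` subset_products G j B \<subseteq> subset_products G (j + card F) A"
  proof (rule image_subsetI)
    fix z assume "z \<in> subset_products G j B"
    then obtain T where T: "z = (\<Otimes>x\<in>T. x)" "T \<subseteq> B" "finite T" "card T = j"
      by (auto simp: subset_products_def)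
    have "z \<otimes> ?f = (\<Otimes>x\<in>T \<union> F. x)"
      unfolding T(1) using T assms(4) fin carr
      by (subst finprod_Un_disjoint) auto
    moreover have "card (T \<union> F) = j + card F"
      using T fin assms(4) by (subst card_Un_disjoint) auto
    ultimately show "z \<otimes> ?f \<in> subset_products G (j + card F) A"
      unfolding subset_products_def using T fin assms(3)
      by (intro CollectI exI[of _ "T \<union> F"]) auto
  qed
qed

text \<open>Cauchy-Davenport adds one fibre at a time: the bounds minus one accumulate, and the cap
  at \<open>p\<close> persists.\<close>

lemma card_fiberwise_products:
  fixes A :: "nat \<Rightarrow> 'a set" and \<kappa> :: "nat \<Rightarrow> nat"
  assumes fin: "finite (carrier G)" and p: "\<And>r. prime r \<Longrightarrow> r dvd order G \<Longrightarrow> p \<le> r"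
    and A: "\<And>v. A v \<subseteq> carrier G" and disj: "\<And>v w. v \<noteq> w \<Longrightarrow> A v \<inter> A w = {}"
    and \<kappa>: "\<And>v. v < t \<Longrightarrow> \<kappa> v \<le> card (A v)"
    and bound: "\<And>v. v < t \<Longrightarrow>
      min p (\<kappa> v * (card (A v) - \<kappa> v) + 1) \<le> card (subset_products G (\<kappa> v) (A v))"
  shows "min p ((\<Sum>v<t. \<kappa> v * (card (A v) - \<kappa> v)) + 1) \<le>
    card {(\<Otimes>x\<in>T. x) | T. T \<subseteq> (\<Union>v<t. A v) \<and> (\<forall>v<t. card (T \<inter> A v) = \<kappa> v)}"
    (is "_ \<le> card (?P t)")
  using \<kappa> bound
proof (induction t)
  case 0
  have "?P 0 = {\<one>}" by auto
  then show ?case by simp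
next
  case (Suc t)
  have finA: "finite (A v)" for v using A fin by (rule finite_subset)
  let ?S = "subset_products G (\<kappa> t) (A t)"
  have closed: "?P t \<subseteq> carrier G" for t
  proof
    fix z assume "z \<in> ?P t"
    then obtain T where "z = (\<Otimes>x\<in>T. x)" "T \<subseteq> (\<Union>v<t. A v)" by blast
    moreover from this have "T \<subseteq> carrier G" using A by blast
    ultimately show "z \<in> carrier G" by (auto intro!: finprod_closed)
  qed
  have finP: "finite (?P t)" for t
    using closed fin by (rule finite_subset)
  have IH: "min p ((\<Sum>v<t. \<kappa> v * (card (A v) - \<kappa> v)) + 1) \<le> card (?P t)"
    using Suc by simp
  \<comment> \<open>The sets \<open>U v\<close> witness that \<open>?P t\<close> is non-empty, as
    Cauchy-Davenport requires.\<close>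
  have "\<exists>U. \<forall>v. U v \<subseteq> A v \<and> (v < t \<longrightarrow> card (U v) = \<kappa> v)"
    using Suc.prems(1) by (intro choice allI) (meson empty_subsetI less_Suc_eq obtain_subset_with_card_n)
  then obtain U where U: "\<And>v. U v \<subseteq> A v" "\<And>v. v < t \<Longrightarrow> card (U v) = \<kappa> v" by blast
  have "(\<Union>v<t. U v) \<inter> A w = U w" if "w < t" for w
  proof (rule subset_antisym; rule subsetI)
    fix x assume "x \<in> (\<Union>v<t. U v) \<inter> A w"
    then obtain v where "x \<in> U v" "x \<in> A v \<inter> A w" using U(1) by blast
    then show "x \<in> U w" using disj[of v w] by (cases "v = w") auto
  next
    fix x assume "x \<in> U w"
    then show "x \<in> (\<Union>v<t. U v) \<inter> A w" using U(1) that by blast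
  qed
  then have "(\<Otimes>x\<in>(\<Union>v<t. U v). x) \<in> ?P t"
    using U by (intro CollectI exI[of _ "\<Union>v<t. U v"] conjI refl) (blast, simp)
  then have ne: "?P t \<noteq> {}" by blast
  have "?P t <#> ?S \<subseteq> ?P (Suc t)"
  proof
    fix z assume "z \<in> ?P t <#> ?S"
    then obtain T V where TV: "z = (\<Otimes>x\<in>T. x) \<otimes> (\<Otimes>x\<in>V. x)" "T \<subseteq> (\<Union>v<t. A v)"
        "\<forall>v<t. card (T \<inter> A v) = \<kappa> v" "V \<subseteq> A t" "card V = \<kappa> t"
      unfolding set_mult_def subset_products_def by blast
    have "finite T" using finA TV(2) by (meson finite_UN finite_lessThan finite_subset)
    moreover have "finite V" using finA TV(4) by (rule finite_subset[rotated])
    moreover have TA: "T \<inter> A t = {}"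
    proof -
      have "A v \<inter> A t = {}" if "v < t" for v
        using disj[of v t] that by simp
      then show ?thesis using TV(2) by blast
    qed
    ultimately have "z = (\<Otimes>x\<in>T \<union> V. x)"
      unfolding TV(1) using TV A by (subst finprod_Un_disjoint) blast+
    moreover have "(T \<union> V) \<inter> A v = T \<inter> A v" if "v < t" for v
      using TV(4) disj[of v t] that by auto
    moreover have "(T \<union> V) \<inter> A t = V" using TA TV(4) by auto
    moreover have "T \<union> V \<subseteq> (\<Union>v<Suc t. A v)"
      using TV(2,4) by (fastforce simp: lessThan_Suc)
    ultimately show "z \<in> ?P (Suc t)"
      using TV(3,5) by (intro CollectI exI[of _ "T \<union> V"]) (simp add: less_Suc_eq)
  qed
  then have "card (?P t <#> ?S) \<le> card (?P (Suc t))"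
    by (rule card_mono[OF finP])
  moreover have "min p (card (?P t) + card ?S - 1) \<le> card (?P t <#> ?S)"
    by (rule Cauchy_Davenport[OF fin p closed ne subset_products_closed[OF A]
        subset_products_nonempty[OF finA]]) (use Suc.prems in auto)
  moreover have "0 < card (?P t)" using ne finP by (simp add: card_gt_0_iff)
  moreover have "min p (\<kappa> t * (card (A t) - \<kappa> t) + 1) \<le> card ?S"
    using Suc.prems(2) by simp
  ultimately show ?case using IH unfolding sum.lessThan_Suc by linarith
qed

text \<open>The induction step for at most \<open>q\<close> elements. Multiplication by
  \<open>inv a0\<close> moves \<open>A\<close> into \<open>H\<close>, where \<open>\<pi>\<close>
  sorts it into cosets of \<open>K\<close>; the fibrewise bounds then feed
  \<open>multiset_Dias_da_Silva_Hamidoune\<close>.\<close>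

lemma card_subset_products_small:
  assumes fin: "finite (carrier G)" and p: "\<And>r. prime r \<Longrightarrow> r dvd order G \<Longrightarrow> p \<le> r"
    and "prime q" "p \<le> q" and H: "subgroup H G" and K: "subgroup K G"
    and \<pi>_less: "\<And>x. x \<in> H \<Longrightarrow> \<pi> x < q"
    and \<pi>_mult: "\<And>x y. x \<in> H \<Longrightarrow> y \<in> H \<Longrightarrow> \<pi> (x \<otimes> y) = (\<pi> x + \<pi> y) mod q"
    and \<pi>_ker: "\<And>x. x \<in> H \<Longrightarrow> \<pi> x = 0 \<Longrightarrow> x \<in> K"
    and a0: "a0 \<in> carrier G" and A: "A \<subseteq> H #> a0" "card A \<le> q" "k \<le> card A"
    and IH: "\<And>a B j. a \<in> carrier G \<Longrightarrow> B \<subseteq> K #> a \<Longrightarrow> j \<le> card B \<Longrightarrow>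
      min p (j * (card B - j) + 1) \<le> card (subset_products G j B)"
  shows "min p (k * (card A - k) + 1) \<le> card (subset_products G k A)"
proof -
  have "q > 0" using \<open>prime q\<close> by (simp add: prime_gt_0_nat)
  have Hcarr: "x \<in> carrier G" if "x \<in> H" for x using that subgroup.subset[OF H] by blast
  have Acarr: "A \<subseteq> carrier G"
    using A(1) r_coset_subset_G[OF subgroup.subset[OF H] a0] by blast
  have finA: "finite A" using Acarr fin by (rule finite_subset)
  have AH: "a \<otimes> inv a0 \<in> H" if a: "a \<in> A" for a
  proof -
    obtain h where "h \<in> H" "a = h \<otimes> a0" using a A(1) by (auto simp: r_coset_def)
    then show ?thesis using a0 Hcarr by (simp add: m_assoc)
  qed
  have \<pi>_one: "\<pi> \<one> = 0"
  proof -
    have "\<pi> \<one> = (\<pi> \<one> + \<pi> \<one>) mod q" "\<pi> \<one> < q"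
      using \<pi>_mult[of \<one> \<one>] \<pi>_less subgroup.one_closed[OF H] by auto
    then show ?thesis by (cases "\<pi> \<one> + \<pi> \<one> < q") (auto simp: le_mod_geq)
  qed
  define b where "b a = \<pi> (a \<otimes> inv a0)" for a
  have b: "b a < q" if "a \<in> A" for a
    using \<pi>_less[OF AH[OF that]] by (simp add: b_def)
  define F where "F v = {a \<in> A. b a = v}" for v
  have FA: "F v \<subseteq> A" "finite (F v)" for v using finA by (auto simp: F_def)
  have F_disj: "F v \<inter> F w = {}" if "v \<noteq> w" for v w using that by (auto simp: F_def)
  have F_Un: "(\<Union>v<q. F v) = A" using b by (auto simp: F_def)
  have sum_F: "(\<Sum>a\<in>T. f (b a)) = (\<Sum>v<q. card (T \<inter> F v) * f v)"
    if T: "T \<subseteq> A" for T and f :: "nat \<Rightarrow> nat"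
  proof -
    have "finite T" using T finA by (rule finite_subset)
    then have "(\<Sum>a\<in>T. f (b a)) = (\<Sum>v<q. \<Sum>a | a \<in> T \<and> b a = v. f (b a))"
      using b T by (intro sum.group[symmetric]) auto
    also have "\<dots> = (\<Sum>v<q. card (T \<inter> F v) * f v)"
    proof (intro sum.cong refl)
      fix v
      have "{a. a \<in> T \<and> b a = v} = T \<inter> F v" using T by (auto simp: F_def)
      then show "(\<Sum>a | a \<in> T \<and> b a = v. f (b a)) = card (T \<inter> F v) * f v"
        by (simp add: F_def)
    qed
    finally show ?thesis .
  qed
  have sum_n: "(\<Sum>v<q. card (F v)) = card A"
    using sum_F[of A "\<lambda>_. 1"] FA by (simp add: Int_absorb1)
  let ?C = "subset_products G k A"
  have finC: "finite ?C" by (rule finite_subset_products[OF finA])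
  \<comment> \<open>A product of \<open>k\<close> elements of \<open>A\<close> lies in
    \<open>H\<close> only after multiplication by \<open>k\<close> copies of
    \<open>inv a0\<close>.\<close>
  define \<psi> where "\<psi> c = \<pi> (c \<otimes> inv a0 [^] k)" for c
  define m where "m y = card {c \<in> ?C. \<psi> c = y}" for y
  have \<psi>: "\<psi> (\<Otimes>x\<in>T. x) = (\<Sum>a\<in>T. b a) mod q" if T: "T \<subseteq> A" "card T = k" for T
  proof -
    have finT: "finite T" using T finA by (auto intro: finite_subset)
    have "\<pi> (\<Otimes>x\<in>T. x \<otimes> inv a0) = (\<Sum>a\<in>T. b a) mod q \<and> (\<Otimes>x\<in>T. x \<otimes> inv a0) \<in> H"
      using finT T(1)
    proof (induction T rule: finite_induct)
      case empty
      then show ?case using \<pi>_one subgroup.one_closed[OF H] by simp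
    next
      case (insert x T)
      then have "(\<Otimes>x\<in>insert x T. x \<otimes> inv a0) = (x \<otimes> inv a0) \<otimes> (\<Otimes>x\<in>T. x \<otimes> inv a0)"
        using a0 Acarr by (intro finprod_insert) auto
      then show ?case
        using insert \<pi>_mult[of "x \<otimes> inv a0" "\<Otimes>x\<in>T. x \<otimes> inv a0"] AH[of x]
          subgroup.m_closed[OF H, of "x \<otimes> inv a0" "\<Otimes>x\<in>T. x \<otimes> inv a0"]
        by (auto simp: b_def mod_simps)
    qed
    moreover have "(\<Otimes>x\<in>T. x \<otimes> inv a0) = (\<Otimes>x\<in>T. x) \<otimes> (\<Otimes>x\<in>T. inv a0)"
      using T a0 Acarr by (intro finprod_multf) auto
    moreover have "(\<Otimes>x\<in>T. inv a0) = inv a0 [^] k"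
      using a0 T(2) by (simp add: finprod_const)
    ultimately show ?thesis by (simp add: \<psi>_def)
  qed
  have sum_m: "(\<Sum>y<q. m y) \<le> card ?C"
  proof -
    have "(\<Sum>y<q. m y) = card (\<Union>y<q. {c \<in> ?C. \<psi> c = y})"
      unfolding m_def using finC by (intro card_UN_disjoint[symmetric]) auto
    also have "\<dots> \<le> card ?C" using finC by (intro card_mono) auto
    finally show ?thesis .
  qed
  have m_bound: "min p ((\<Sum>v<q. \<kappa> v * (card (F v) - \<kappa> v)) + 1) \<le> m ((\<Sum>v<q. \<kappa> v * v) mod q)"
    if \<kappa>: "\<And>v. v < q \<Longrightarrow> \<kappa> v \<le> card (F v)" "(\<Sum>v<q. \<kappa> v) = k" for \<kappa>
  proof -
    let ?P = "{(\<Otimes>x\<in>T. x) | T. T \<subseteq> (\<Union>v<q. F v) \<and> (\<forall>v<q. card (T \<inter> F v) = \<kappa> v)}"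
    have "min p ((\<Sum>v<q. \<kappa> v * (card (F v) - \<kappa> v)) + 1) \<le> card ?P"
    proof (rule card_fiberwise_products[OF fin p])
      show "F v \<subseteq> carrier G" for v using FA Acarr by blast
      show "F v \<inter> F w = {}" if "v \<noteq> w" for v w using that by (rule F_disj)
      show "\<kappa> v \<le> card (F v)" if "v < q" for v using that by (rule \<kappa>)
      fix v assume v: "v < q"
      \<comment> \<open>Quotients of elements of \<open>F v\<close> have character value 0 and so
        lie in \<open>K\<close>; any element of the fibre represents its coset.\<close>
      obtain a where a: "a \<in> carrier G" "F v \<subseteq> K #> a"
      proof (cases "F v = {}")
        case True
        then show ?thesis using that a0 by blast
      next
        case False
        then obtain a where a: "a \<in> F v" by blast
        then have acarr: "a \<in> carrier G" using FA Acarr by blast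
        have "F v \<subseteq> K #> a"
        proof
          fix x assume x: "x \<in> F v"
          then have xcarr: "x \<in> carrier G" using FA Acarr by blast
          have xH: "x \<otimes> inv a0 \<in> H" and aH: "a \<otimes> inv a0 \<in> H" using x a AH FA by auto
          have xa: "x \<otimes> inv a = (x \<otimes> inv a0) \<otimes> inv (a \<otimes> inv a0)"
          proof -
            have "inv a0 \<otimes> (inv a \<otimes> a0) = inv a"
              using acarr a0 m_comm[of "inv a" a0] by (simp add: m_assoc[symmetric])
            then show ?thesis using xcarr acarr a0 by (simp add: inv_mult m_assoc)
          qed
          then have xaH: "x \<otimes> inv a \<in> H"
            using xH subgroup.m_inv_closed[OF H aH] subgroup.m_closed[OF H] by simp
          have "(x \<otimes> inv a) \<otimes> (a \<otimes> inv a0) = x \<otimes> inv a0"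
          proof -
            have "inv a \<otimes> (a \<otimes> inv a0) = inv a0"
              using acarr a0 by (simp add: m_assoc[symmetric])
            then show ?thesis using xcarr acarr a0 by (simp add: m_assoc)
          qed
          then have "(\<pi> (x \<otimes> inv a) + v) mod q = v"
            using \<pi>_mult[OF xaH aH] x a by (simp add: F_def b_def)
          moreover have "\<pi> (x \<otimes> inv a) < q" using \<pi>_less[OF xaH] .
          ultimately have "\<pi> (x \<otimes> inv a) = 0"
            using v by (cases "\<pi> (x \<otimes> inv a) + v < q") (auto simp: le_mod_geq)
          then have "x \<otimes> inv a \<in> K" using \<pi>_ker[OF xaH] by blast
          moreover have "x = (x \<otimes> inv a) \<otimes> a" using xcarr acarr by (simp add: m_assoc)
          ultimately show "x \<in> K #> a" by (auto simp: r_coset_def)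
        qed
        then show ?thesis using that acarr by blast
      qed
      show "min p (\<kappa> v * (card (F v) - \<kappa> v) + 1) \<le> card (subset_products G (\<kappa> v) (F v))"
        by (rule IH[OF a \<kappa>(1)[OF v]])
    qed
    also have "\<dots> \<le> m ((\<Sum>v<q. \<kappa> v * v) mod q)"
      unfolding m_def
    proof (rule card_mono)
      show "finite {c \<in> ?C. \<psi> c = (\<Sum>v<q. \<kappa> v * v) mod q}" using finC by simp
      show "?P \<subseteq> {c \<in> ?C. \<psi> c = (\<Sum>v<q. \<kappa> v * v) mod q}"
      proof
        fix z assume "z \<in> ?P"
        then obtain T where T: "z = (\<Otimes>x\<in>T. x)" "T \<subseteq> A" "\<And>v. v < q \<Longrightarrow> card (T \<inter> F v) = \<kappa> v"
          unfolding F_Un by blast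
        have "card T = k"
          using sum_F[OF T(2), of "\<lambda>_. 1"] T(3) \<kappa>(2) by simp
        moreover have "(\<Sum>a\<in>T. b a) = (\<Sum>v<q. \<kappa> v * v)"
          using sum_F[OF T(2), of "\<lambda>v. v"] T(3) by simp
        moreover have "finite T" using T(2) finA by (rule finite_subset)
        ultimately show "z \<in> {c \<in> ?C. \<psi> c = (\<Sum>v<q. \<kappa> v * v) mod q}"
          using T(1,2) \<psi>[of T] unfolding subset_products_def by auto
      qed
    qed
    finally show ?thesis .
  qed
  show ?thesis
  \<comment> \<open>One coset with \<open>p\<close> elements suffices. Otherwise the cap at
    \<open>p\<close> is inactive in every \<open>m_bound\<close>, which gives the required strict
    inequalities.\<close>
  proof (cases "\<exists>y<q. p \<le> m y")
    case True
    then obtain y where "y < q" "p \<le> m y" by blast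
    moreover have "m y \<le> (\<Sum>y<q. m y)"
      using \<open>y < q\<close> by (intro member_le_sum) auto
    ultimately show ?thesis using sum_m by linarith
  next
    case False
    have "(\<Sum>v<q. \<kappa> v * (card (F v) - \<kappa> v)) < m ((\<Sum>v<q. \<kappa> v * v) mod q)"
      if "\<And>v. v < q \<Longrightarrow> \<kappa> v \<le> card (F v)" "(\<Sum>v<q. \<kappa> v) = k" for \<kappa>
    proof -
      have "m ((\<Sum>v<q. \<kappa> v * v) mod q) < p"
        using False \<open>q > 0\<close> by (meson mod_less_divisor not_le)
      then show ?thesis using m_bound[OF that] by linarith
    qed
    then have "min q (k * (card A - k) + 1) \<le> (\<Sum>y<q. m y)"
      by (rule multiset_Dias_da_Silva_Hamidoune[OF \<open>prime q\<close> sum_n A(2,3)])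
    then show ?thesis using sum_m \<open>p \<le> q\<close> by linarith
  qed
qed

text \<open>Strong induction on the size of \<open>H\<close>, over all cosets and all
  \<open>k\<close>, because the fibres of \<open>A\<close> lie in cosets of a smaller subgroup. Sets
  with more than \<open>q\<close> elements reduce to \<open>q\<close>-element subsets.\<close>

lemma card_subset_products_coset:
  assumes fin: "finite (carrier G)" and p: "\<And>r. prime r \<Longrightarrow> r dvd order G \<Longrightarrow> p \<le> r"
    and "subgroup H G" "a0 \<in> carrier G" "A \<subseteq> H #> a0" "k \<le> card A"
  shows "min p (k * (card A - k) + 1) \<le> card (subset_products G k A)"
  using assms(3-)
proof (induction "card H" arbitrary: H a0 A k rule: less_induct)
  case less
  note H = less.prems(1)
  have Acarr: "A \<subseteq> carrier G"
    using less.prems(2,3) r_coset_subset_G[OF subgroup.subset[OF H]] by blast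
  have finA: "finite A" using Acarr fin by (rule finite_subset)
  have finH: "finite H" using subgroup.subset[OF H] fin by (rule finite_subset)
  show ?case
  proof (cases "k = 0 \<or> k = card A")
    case True
    have "0 < card (subset_products G k A)"
      using subset_products_nonempty[OF finA less.prems(4)] finite_subset_products[OF finA]
      by (simp add: card_gt_0_iff)
    then show ?thesis using True by auto
  next
    case False
    then have k: "0 < k" "k < card A" using less.prems(4) by auto
    have "H \<noteq> {\<one>}"
    proof
      assume "H = {\<one>}"
      then have "A \<subseteq> {a0}" using less.prems(2,3) by (auto simp: r_coset_def)
      then have "card A \<le> 1" using card_mono[of "{a0}" A] by simp
      then show False using k by simp
    qed
    then obtain K q and \<pi> :: "'a \<Rightarrow> nat" where K: "subgroup K G" "K \<subset> H"
      and q: "prime q" "q dvd order G"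
      and \<pi>: "\<And>x. x \<in> H \<Longrightarrow> \<pi> x < q"
        "\<And>x y. x \<in> H \<Longrightarrow> y \<in> H \<Longrightarrow> \<pi> (x \<otimes> y) = (\<pi> x + \<pi> y) mod q"
        "\<And>x. x \<in> H \<Longrightarrow> \<pi> x = 0 \<Longrightarrow> x \<in> K"
      using exists_prime_index_character[OF fin H] by metis
    have "p \<le> q" using p q by blast
    have IH: "min p (j * (card B - j) + 1) \<le> card (subset_products G j B)"
      if "a \<in> carrier G" "B \<subseteq> K #> a" "j \<le> card B" for a B j
      using psubset_card_mono[OF finH K(2)] K(1) that by (rule less.hyps)
    have small: "min p (j * (card B - j) + 1) \<le> card (subset_products G j B)"
      if "B \<subseteq> A" "card B \<le> q" "j \<le> card B" for B j
      by (rule card_subset_products_small[OF fin p q(1) \<open>p \<le> q\<close> H K(1) \<pi> less.prems(2) _ that(2,3) IH])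
        (use that less.prems(3) in auto)
    show ?thesis
    proof (cases "card A \<le> q")
      case True
      then show ?thesis using small[of A k] less.prems(4) by simp
    next
      case False
      \<comment> \<open>Fix \<open>k - j\<close> of the summands and choose the other \<open>j\<close> from \<open>q\<close> of the remaining elements.\<close>
      define j where "j = (if q \<le> card A - k then 1 else q - (card A - k))"
      have "1 < q" using q(1) by (rule prime_gt_1_nat)
      then have j: "1 \<le> j" "j \<le> k" "j < q" "q + (k - j) \<le> card A"
        using k False by (auto simp: j_def)
      obtain B where B: "B \<subseteq> A" "card B = q"
        using False obtain_subset_with_card_n[of q A] by auto
      then have "card (A - B) = card A - q"
        using finA by (simp add: card_Diff_subset finite_subset)
      then have "k - j \<le> card (A - B)" using j(4) by linarith
      then obtain F where F: "F \<subseteq> A - B" "card F = k - j"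
        using obtain_subset_with_card_n by metis
      \<comment> \<open>On the range from 1 to \<open>q - 1\<close> the product
        \<open>j * (q - j)\<close> is smallest at the ends, where it equals
        \<open>q - 1\<close>.\<close>
      have "q \<le> j * (q - j) + 1"
      proof -
        have "(j - 1) * (q - j - 1) + (q - 1) = j * (q - j)"
        proof -
          obtain i where i: "j = Suc i" using j(1) by (cases j) auto
          obtain l where "q = j + Suc l" using j(3) less_imp_Suc_add by fastforce
          then show ?thesis using i by simp
        qed
        then show ?thesis using \<open>1 < q\<close> by linarith
      qed
      then have "p \<le> card (subset_products G j B)"
        using small[of B j] B j \<open>p \<le> q\<close> by simp
      also have "\<dots> \<le> card (subset_products G (j + card F) A)"
        by (rule card_subset_products_le[OF finA Acarr]) (use B F in auto)
      finally show ?thesis using F(2) j(2) by simp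
    qed
  qed
qed

end

theorem theorem1p1:
  fixes G :: "('a, 'b) monoid_scheme" (structure)
    and A :: "'a set" and k :: nat
  assumes "comm_group G"
    and "finite (carrier G)"
    and "order G > 1"
    and "A \<subseteq> carrier G"
    and "A \<noteq> {}"
  shows "int (card (restricted_sumset G k A)) \<ge>
           min (int (least_prime_divisor (order G)))
               (int k * int (card A) - (int k)^2 + 1)"
proof (cases "k \<le> card A")
  case True
  interpret comm_group G by fact
  have "least_prime_divisor (order G) \<le> r" if "prime r" "r dvd order G" for r
    unfolding least_prime_divisor_def using that by (intro Least_le) simp
  moreover have "A \<subseteq> carrier G #> \<one>"
    using assms(4) by (auto simp: r_coset_def)
  ultimately have "min (least_prime_divisor (order G)) (k * (card A - k) + 1) \<le>
      card (restricted_sumset G k A)"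
    unfolding restricted_sumset_eq_subset_products[OF assms(4)]
    by (intro card_subset_products_coset[OF assms(2) _ subgroup_self one_closed _ True]) auto
  moreover have "int (k * (card A - k) + 1) = int k * int (card A) - (int k)^2 + 1"
    using True by (simp add: of_nat_diff power2_eq_square right_diff_distrib)
  ultimately show ?thesis by linarith
next
  case False
  \<comment> \<open>For \<open>k\<close> above \<open>card A\<close> the claimed lower bound is at
    most \<open>1 - k\<close>, hence at most 0.\<close>
  then have "int k * int (card A) + int k \<le> int k * int k"
    by (metis distrib_left mult.right_neutral mult_left_mono not_less_eq_eq of_nat_0_le_iff
        of_nat_Suc of_nat_le_iff add.commute)
  moreover have "1 \<le> int k" using False by simp
  ultimately show ?thesis by (simp add: power2_eq_square)
qed

end
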